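(* Let $\mathbb{K}\in\{\mathbb{R},\mathbb{C}\}$ and let $X$ be one of the spaces $Mat_{m\times n}(\mathbb{K})$ ($m\le n$) of $m\times n$ matrices, $Mat^{sym}_{n\times n}(\mathbb{K})$ of symmetric $n\times n$ matrices, or $Mat^{skew\text{-}sym}_{n\times n}(\mathbb{K})$ of skew-symmetric $n\times n$ matrices (in the last two cases $m=n$). For an integer $r$ let $X_r=\{A\in X : \operatorname{rank}(A)=r\}$. Suppose $A,B$ belong to the same connected component of $X_r$, for some $r\le m$. Then $$\frac{d_{in}^{X_r}(A,B)}{2\sqrt{2}}\ \le\ d_{out}(A,B)\ \le\ d_{in}^{X_r}(A,B).$$
   Context: The space $Mat_{m\times n}(\mathbb{K})\cong\mathbb{K}^{mn}$ carries the inner product $\langle A,B\rangle=\operatorname{trace}(A\overline{B}^{t})$, and $d_{out}(A,B)=\sqrt{\operatorname{trace}\big((A-B)\overline{(A-B)}^{t}\big)}$ is the corresponding Euclidean distance. For a subset $Y$ of a Euclidean space and $x,y\in Y$, the inner distance $d_{in}^{Y}(x,y)$ is the infimum of the Euclidean lengths of rectifiable paths $\gamma:[0,1]\to Y$ with $\gamma(0)=x$, $\gamma(1)=y$. *)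

theory Defs
  imports "HOL-Analysis.Analysis"
begin

definition sym_matrices :: "('a::comm_ring_1 ^ 'n ^ 'n) set"
  where "sym_matrices = {A. transpose A = A}"

text \<open>Over the complex numbers these are the symmetric and skew-symmetric matrices in the
  bilinear sense; there is no conjugation in the transpose.\<close>

definition skew_matrices :: "('a::comm_ring_1 ^ 'n ^ 'n) set"
  where "skew_matrices = {A. transpose A = - A}"

definition rank_stratum :: "('a::field ^ 'n ^ 'm) set \<Rightarrow> nat \<Rightarrow> ('a ^ 'n ^ 'm) set"
  where "rank_stratum X r = {A \<in> X. rank A = r}"

definition d_out_real :: "real ^ 'n ^ 'm \<Rightarrow> real ^ 'n ^ 'm \<Rightarrow> real"
  where "d_out_real A B = sqrt (trace ((A - B) ** transpose (A - B)))"

text \<open>The trace below is always a nonnegative real number; taking the real part only adjusts the type.\<close>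

definition d_out_complex :: "complex ^ 'n ^ 'm \<Rightarrow> complex ^ 'n ^ 'm \<Rightarrow> real"
  where "d_out_complex A B = sqrt (Re (trace ((A - B) ** transpose (map_matrix cnj (A - B)))))"

text \<open>Length of a curve on \<open>{0..1}\<close>: the supremum of the lengths of inscribed polygons, where the
  vertices of a polygon are given by a sorted list of parameters. The distance used is the one of
  the type; for matrices it is the Euclidean one, by the lemmas
  \<open>d_out_real_eq_dist\<close> and \<open>d_out_complex_eq_dist\<close>.\<close>

definition curve_length :: "(real \<Rightarrow> 'a::metric_space) \<Rightarrow> ereal"
  where "curve_length g =
    (SUP ts \<in> {ts. sorted ts \<and> set ts \<subseteq> {0..1}}.
       ereal (\<Sum>i < length ts - 1. dist (g (ts ! i)) (g (ts ! Suc i))))"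

definition rectifiable_path :: "(real \<Rightarrow> 'a::metric_space) \<Rightarrow> bool"
  where "rectifiable_path g \<longleftrightarrow> path g \<and> curve_length g < \<infinity>"

text \<open>The value is \<open>\<infinity>\<close> if no rectifiable path in \<open>Y\<close> joins the two points.\<close>

definition inner_dist :: "'a::metric_space set \<Rightarrow> 'a \<Rightarrow> 'a \<Rightarrow> ereal"
  where "inner_dist Y x y =
    (INF g \<in> {g. rectifiable_path g \<and> path_image g \<subseteq> Y \<and> pathstart g = x \<and> pathfinish g = y}.
       curve_length g)"

lemma d_out_real_eq_dist: "d_out_real A B = dist A B"
  by (simp add: d_out_real_def dist_norm norm_vec_def L2_set_def trace_def matrix_matrix_mult_def
      transpose_def sum_nonneg power2_eq_square)

lemma d_out_complex_eq_dist: "d_out_complex A B = dist A B"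
proof -
  have "Re (z * cnj z) = (cmod z)\<^sup>2" for z
    by (simp add: complex_mult_cnj cmod_power2)
  then show ?thesis
    by (simp add: d_out_complex_def dist_norm norm_vec_def L2_set_def trace_def
        matrix_matrix_mult_def transpose_def sum_nonneg del: times_complex.sel complex_cnj_diff)
qed

end

theory Submission
  imports Defs
begin

text \<open>The map \<open>A \<mapsto> S = (0, A; A\<^sup>*, 0)\<close> (after writing a complex matrix as a real one) turns all the
  spaces into spaces of real symmetric matrices that anticommute with \<open>J = (1, 0; 0, - 1)\<close> and commute
  with a set of orthogonal matrices. The positive part \<open>K\<close> of \<open>S\<close>, being the nearest point of the cone
  of positive semidefinite matrices, inherits the symmetries; moreover \<open>S = K - J K J\<close>, the rank of \<open>S\<close>
  is twice that of \<open>K\<close>, and \<open>\<surd>2 \<bar>K - L\<bar> \<le> \<bar>S - T\<bar>\<close> for the positive parts \<open>K\<close>, \<open>L\<close> of \<open>S\<close>, \<open>T\<close>.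

  Let \<open>P\<close> be the projection onto the range of \<open>L\<close>. If \<open>P\<close> maps the range of \<open>K\<close> onto that of \<open>L\<close>,
  then \<open>K\<close> is moved to \<open>L\<close> by first shrinking it with \<open>P + t (1 - P)\<close> to \<open>P K P\<close> and then
  interpolating linearly. This gives curves of length at most \<open>\<surd>6 \<bar>S - T\<bar>\<close>, and the Cauchy-Schwarz
  inequality shows that \<open>K - J K J\<close> keeps its rank.

  The condition on \<open>P\<close> can be achieved by arbitrarily small perturbations within a connected component:
  nearby ranges differ by a small rotation respecting the symmetries, the rotations along the Cayley
  curve satisfy the condition outside the zeros of a polynomial, and hence the closure of the set of
  good matrices is open and closed in the stratum. No invariants of the components (determinant,
  signature, Pfaffian) are needed.\<close>

section \<open>Curves controlled by an increment function\<close>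

text \<open>Constant rank of the positive parts along a curve does not suffice:
  \<open>antipart\<close> doubles the rank only as long as the range contains no eigenvector of
  \<open>J\<close>. Positive parts of odd matrices have isotropic ranges, which excludes
  eigenvectors, but isotropy can get lost under the shrinking; \<open>admissible\<close> is the
  weaker property that survives it. The constant arises as follows. With respect to \<open>P\<close>
  the difference \<open>K - L\<close> splits into three mutually orthogonal pieces, and the curve of
  positive parts traverses each of them once, so its length is at most sqrt 3 * |K - L|. Passing to
  \<open>K - J K J\<close> at most doubles lengths, and |K - L| is at most |S - T| / sqrt 2, which
  gives 2 * sqrt 3 / sqrt 2 = sqrt 6. Since sqrt 6 < 2 * sqrt 2, the gap pays for a detour through a
  good matrix close to an endpoint. Defining the positive part as a nearest point replaces spectral
  theory by first variations; even the polar decomposition is read off from the positive part of a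
  dilation. Connectedness enters only in the density argument.\<close>

lemma curve_length_le_increment:
  fixes g :: "real \<Rightarrow> 'a::metric_space"
  assumes h: "\<And>s t. 0 \<le> s \<Longrightarrow> s \<le> t \<Longrightarrow> t \<le> 1 \<Longrightarrow> dist (g s) (g t) \<le> h t - h s"
  shows "curve_length g \<le> ereal (h 1 - h 0)"
  unfolding curve_length_def
proof (rule SUP_least, clarify)
  fix ts :: "real list"
  assume ts: "sorted ts" "set ts \<subseteq> {0..1}"
  have mono: "h s \<le> h t" if "0 \<le> s" "s \<le> t" "t \<le> 1" for s t
    using h[OF that] zero_le_dist[of "g s" "g t"] by linarith
  have rng: "0 \<le> ts ! i" "ts ! i \<le> 1" if "i < length ts" for i
    using ts(2) nth_mem[OF that] by auto
  show "ereal (\<Sum>i<length ts - 1. dist (g (ts ! i)) (g (ts ! Suc i))) \<le> ereal (h 1 - h 0)"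
  proof (cases ts)
    case Nil
    then show ?thesis using mono[of 0 1] by simp
  next
    case (Cons a as)
    then have ne: "0 < length ts" by simp
    have "(\<Sum>i<length ts - 1. dist (g (ts ! i)) (g (ts ! Suc i)))
        \<le> (\<Sum>i<length ts - 1. h (ts ! Suc i) - h (ts ! i))"
      by (intro sum_mono h) (use ts(1) rng in \<open>auto simp: sorted_iff_nth_mono\<close>)
    also have "\<dots> = h (ts ! (length ts - 1)) - h (ts ! 0)"
      by (rule sum_lessThan_telescope)
    also have "\<dots> \<le> h 1 - h 0"
      using mono[of "ts ! (length ts - 1)" 1] mono[of 0 "ts ! 0"]
        rng[of "length ts - 1"] rng[of 0] ne by fastforce
    finally show ?thesis by simp
  qed
qed

text \<open>The polygon with the two parameters 0 and 1 is one of those in the supremum.\<close>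

lemma dist_le_inner_dist: "ereal (dist x y) \<le> inner_dist Y x y"
  unfolding inner_dist_def
proof (rule INF_greatest, clarify)
  fix g :: "real \<Rightarrow> 'a"
  assume "x = pathstart g" "y = pathfinish g"
  then have "ereal (dist x y) = ereal (\<Sum>i<length [0,1::real] - 1. dist (g ([0,1] ! i)) (g ([0,1] ! Suc i)))"
    by (simp add: pathstart_def pathfinish_def)
  also have "\<dots> \<le> curve_length g"
    unfolding curve_length_def by (rule SUP_upper) auto
  finally show "ereal (dist (pathstart g) (pathfinish g)) \<le> curve_length g"
    using \<open>x = _\<close> \<open>y = _\<close> by simp
qed

text \<open>The control function \<open>h\<close> stands in for the supremum in
  \<open>curve_length\<close>: such bounds telescope over any partition, add under concatenation and
  rescale under similarities.\<close>

definition joined_within :: "'a::metric_space set \<Rightarrow> 'a \<Rightarrow> 'a \<Rightarrow> real \<Rightarrow> bool"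
  where "joined_within Y x y L \<longleftrightarrow>
    (\<exists>g h. path g \<and> path_image g \<subseteq> Y \<and> pathstart g = x \<and> pathfinish g = y \<and>
       (\<forall>s t. 0 \<le> s \<and> s \<le> t \<and> t \<le> 1 \<longrightarrow> dist (g s) (g t) \<le> h t - h s) \<and> h 1 - h 0 \<le> (L::real))"

lemma joined_withinI:
  assumes "path g" "path_image g \<subseteq> Y" "pathstart g = x" "pathfinish g = y"
    "\<And>s t. 0 \<le> s \<Longrightarrow> s \<le> t \<Longrightarrow> t \<le> 1 \<Longrightarrow> dist (g s) (g t) \<le> h t - h s" "h 1 - h 0 \<le> L"
  shows "joined_within Y x y L"
  unfolding joined_within_def using assms by blast

lemma inner_dist_le_joined_within:
  assumes "joined_within Y x y L"
  shows "inner_dist Y x y \<le> ereal L"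
proof -
  obtain g h where g: "path g" "path_image g \<subseteq> Y" "pathstart g = x" "pathfinish g = y"
    and h: "\<And>s t. 0 \<le> s \<Longrightarrow> s \<le> t \<Longrightarrow> t \<le> 1 \<Longrightarrow> dist (g s) (g t) \<le> h t - h s"
    and L: "h 1 - h 0 \<le> L"
    using assms unfolding joined_within_def by blast
  have len: "curve_length g \<le> ereal (h 1 - h 0)"
    using h by (rule curve_length_le_increment)
  then have "curve_length g < \<infinity>"
    by (rule order.strict_trans1) simp
  then have "inner_dist Y x y \<le> curve_length g"
    unfolding inner_dist_def rectifiable_path_def using g by (intro INF_lower) auto
  also have "\<dots> \<le> ereal L"
    using len L by (meson ereal_less_eq(3) order_trans)
  finally show ?thesis .
qed

lemma joined_within_mono: "joined_within Y x y L \<Longrightarrow> L \<le> M \<Longrightarrow> joined_within Y x y M"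
  unfolding joined_within_def by (blast intro: order_trans)

lemma joined_within_refl:
  assumes "x \<in> Y" "0 \<le> L"
  shows "joined_within Y x x L"
  by (rule joined_withinI[where g = "\<lambda>_. x" and h = "\<lambda>_. 0"])
     (use assms in \<open>auto simp: path_def path_image_def pathstart_def pathfinish_def\<close>)

lemma joined_within_trans:
  assumes "joined_within Y x y L" "joined_within Y y z M"
  shows "joined_within Y x z (L + M)"
proof -
  obtain g h where g: "path g" "path_image g \<subseteq> Y" "pathstart g = x" "pathfinish g = y"
    and h: "\<And>s t. 0 \<le> s \<Longrightarrow> s \<le> t \<Longrightarrow> t \<le> 1 \<Longrightarrow> dist (g s) (g t) \<le> h t - h s"
    and L: "h 1 - h 0 \<le> L"
    using assms(1) unfolding joined_within_def by blast
  obtain g' h' where g': "path g'" "path_image g' \<subseteq> Y" "pathstart g' = y" "pathfinish g' = z"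
    and h': "\<And>s t. 0 \<le> s \<Longrightarrow> s \<le> t \<Longrightarrow> t \<le> 1 \<Longrightarrow> dist (g' s) (g' t) \<le> h' t - h' s"
    and M: "h' 1 - h' 0 \<le> M"
    using assms(2) unfolding joined_within_def by blast
  \<comment> \<open>The constant \<open>h 1 - h' 0\<close> makes the second control function start
    where the first one ends.\<close>
  define k where "k t = (if t \<le> 1/2 then h (2 * t) else h 1 - h' 0 + h' (2 * t - 1))" for t :: real
  have eq: "g 1 = g' 0" using g g' by (simp add: pathstart_def pathfinish_def)
  show ?thesis
  proof (rule joined_withinI[where g = "g +++ g'" and h = k])
    show "path_image (g +++ g') \<subseteq> Y"
      using g g' by (simp add: path_image_join)
    show "dist ((g +++ g') s) ((g +++ g') t) \<le> k t - k s" if "0 \<le> s" "s \<le> t" "t \<le> 1" for s t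
    proof -
      consider "t \<le> 1/2" | "s > 1/2" | "s \<le> 1/2" "t > 1/2" by linarith
      then show ?thesis
      proof cases
        case 1
        then show ?thesis using that h[of "2 * s" "2 * t"] by (simp add: joinpaths_def k_def)
      next
        case 2
        then show ?thesis using that h'[of "2 * s-1" "2 * t-1"] by (simp add: joinpaths_def k_def)
      next
        case 3
        have "dist (g (2 * s)) (g' (2 * t-1)) \<le> dist (g (2 * s)) (g 1) + dist (g' 0) (g' (2 * t-1))"
          using dist_triangle[of "g (2 * s)" "g' (2 * t-1)" "g 1"] eq by simp
        also have "\<dots> \<le> (h 1 - h (2 * s)) + (h' (2 * t-1) - h' 0)"
          using 3 that by (intro add_mono h h') auto
        finally show ?thesis using 3 by (simp add: joinpaths_def k_def)
      qed
    qed
    show "k 1 - k 0 \<le> L + M" using L M by (simp add: k_def)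
  qed (use g g' in auto)
qed

text \<open>A map that scales all distances by a positive factor is injective, so curves in the
  image pull back through \<open>inv f\<close>.\<close>

lemma joined_within_similarity:
  fixes f :: "'a::metric_space \<Rightarrow> 'b::metric_space"
  assumes f: "\<And>x y. dist (f x) (f y) = c * dist x y" and c: "0 < c"
    and J: "joined_within (f ` Y) (f x) (f y) (c * L)" and xy: "x \<in> Y" "y \<in> Y"
  shows "joined_within Y x y L"
proof -
  obtain g h where g: "path g" "path_image g \<subseteq> f ` Y" "pathstart g = f x" "pathfinish g = f y"
    and h: "\<And>s t. 0 \<le> s \<Longrightarrow> s \<le> t \<Longrightarrow> t \<le> 1 \<Longrightarrow> dist (g s) (g t) \<le> h t - h s"
    and L: "h 1 - h 0 \<le> c * L"
    using J unfolding joined_within_def by blast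
  have inj: "inj f" using f c by (intro injI) (metis dist_eq_0_iff mult_eq_0_iff less_irrefl)
  define k where "k = inv f \<circ> g"
  have gk: "g t = f (k t)" "k t \<in> Y" if "t \<in> {0..1}" for t
  proof -
    have "g t \<in> f ` Y" using g(2) that by (auto simp: path_image_def)
    then show "g t = f (k t)" "k t \<in> Y" using inj by (auto simp: k_def)
  qed
  have dk: "dist (k s) (k t) = dist (g s) (g t) / c" if "s \<in> {0..1}" "t \<in> {0..1}" for s t
    using gk(1)[OF that(1)] gk(1)[OF that(2)] f c by simp
  show ?thesis
  proof (rule joined_withinI[where g = k and h = "\<lambda>t. h t / c"])
    show "path k"
      unfolding path_def continuous_on_iff
    proof (intro ballI allI impI)
      fix t e :: real assume t: "t \<in> {0..1}" and e: "0 < e"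
      then obtain d where d: "d > 0" "\<And>s. s \<in> {0..1} \<Longrightarrow> dist s t < d \<Longrightarrow> dist (g s) (g t) < c * e"
        using g(1) c unfolding path_def continuous_on_iff by (metis mult_pos_pos)
      have "dist (k s) (k t) < e" if "s \<in> {0..1}" "dist s t < d" for s
        using d(2)[OF that] dk[OF that(1) t] c by (simp add: pos_divide_less_eq mult.commute)
      then show "\<exists>d>0. \<forall>s\<in>{0..1}. dist s t < d \<longrightarrow> dist (k s) (k t) < e"
        using d(1) by blast
    qed
    show "path_image k \<subseteq> Y" using gk(2) by (auto simp: path_image_def)
    show "pathstart k = x" "pathfinish k = y"
      using g(3,4) inj by (auto simp: k_def pathstart_def pathfinish_def)
    show "dist (k s) (k t) \<le> h t / c - h s / c" if "0 \<le> s" "s \<le> t" "t \<le> 1" for s t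
      using dk[of s t] h[OF that] that c by (simp add: divide_right_mono flip: diff_divide_distrib)
    show "h 1 / c - h 0 / c \<le> L"
      using L c by (simp add: pos_divide_le_eq mult.commute flip: diff_divide_distrib)
  qed
qed

lemma connected_component_continuous_image:
  assumes "continuous_on Y f" "connected_component Y x y"
  shows "connected_component (f ` Y) (f x) (f y)"
proof -
  obtain T where "connected T" "T \<subseteq> Y" "x \<in> T" "y \<in> T"
    using assms(2) unfolding connected_component_def by blast
  then show ?thesis
    unfolding connected_component_def
    by (meson assms(1) connected_continuous_image continuous_on_subset image_eqI image_mono)
qed

section \<open>Positive semidefinite matrices\<close>

lemma matrix_diff_ldistrib: "A ** (B - C) = A ** B - A ** (C :: 'a::ring_1 ^ 'p ^ 'n)"
  by (vector matrix_matrix_mult_def sum_subtractf algebra_simps)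

lemma matrix_diff_rdistrib: "(A - B) ** C = A ** C - B ** (C :: 'a::ring_1 ^ 'p ^ 'n)"
  by (vector matrix_matrix_mult_def sum_subtractf algebra_simps)

lemma matrix_add_rdistrib: "(A + B) ** C = A ** C + B ** (C :: 'a::ring_1 ^ 'p ^ 'n)"
  by (vector matrix_matrix_mult_def sum.distrib algebra_simps)

lemma matrix_minus_left: "(- A) ** B = - (A ** (B :: 'a::ring_1 ^ 'p ^ 'n))"
  by (vector matrix_matrix_mult_def sum_negf)

lemma matrix_minus_right: "A ** (- B) = - (A ** (B :: 'a::ring_1 ^ 'p ^ 'n))"
  by (vector matrix_matrix_mult_def sum_negf)

lemma matrix_scaleR_left: "(c *\<^sub>R A) ** B = c *\<^sub>R (A ** (B :: real ^ 'p ^ 'n))"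
  by (vector matrix_matrix_mult_def sum_distrib_left algebra_simps)

lemma matrix_scaleR_right: "A ** (c *\<^sub>R B) = c *\<^sub>R (A ** (B :: real ^ 'p ^ 'n))"
  by (vector matrix_matrix_mult_def sum_distrib_left algebra_simps)

lemma transpose_add: "transpose (A + B) = transpose A + transpose B"
  by (vector transpose_def)

lemma transpose_diff: "transpose (A - B) = transpose A - transpose (B :: 'a::ring_1 ^ 'p ^ 'n)"
  by (vector transpose_def)

lemma transpose_minus: "transpose (- B) = - transpose (B :: 'a::ring_1 ^ 'p ^ 'n)"
  by (vector transpose_def)

lemma transpose_zero [simp]: "transpose 0 = (0 :: 'a::ring_1 ^ 'p ^ 'n)"
  by (vector transpose_def)

lemma matrix_mult_zero_left [simp]: "0 ** A = (0 :: 'a::ring_1 ^ 'p ^ 'm)"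
  by (vector matrix_matrix_mult_def)

lemma matrix_mult_zero_right [simp]: "A ** 0 = (0 :: 'a::ring_1 ^ 'p ^ 'm)"
  by (vector matrix_matrix_mult_def)

lemma matrix_vector_minus_left: "(- A) *v x = - (A *v (x :: 'a::ring_1 ^ 'n))"
  by (vector matrix_vector_mult_def sum_negf)

lemma matrix_vector_minus_right: "A *v (- x) = - (A *v (x :: 'a::ring_1 ^ 'n))"
  by (vector matrix_vector_mult_def sum_negf)

lemma matrix_vector_scaleR_left: "(c *\<^sub>R A) *v x = c *\<^sub>R (A *v (x :: real ^ 'n))"
  by (vector matrix_vector_mult_def sum_distrib_left algebra_simps)

lemmas matrix_arith = matrix_diff_ldistrib matrix_diff_rdistrib matrix_add_ldistrib
  matrix_add_rdistrib matrix_minus_left matrix_minus_right matrix_scaleR_left matrix_scaleR_right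
  matrix_mul_assoc matrix_transpose_mul transpose_add transpose_diff transpose_minus transpose_scalar

lemmas matrix_vector_arith = matrix_vector_right_distrib matrix_vector_mult_diff_distrib
  matrix_vector_mult_add_rdistrib matrix_vector_mult_diff_rdistrib matrix_vector_minus_left
  matrix_vector_minus_right matrix_vector_mult_scaleR matrix_vector_scaleR_left

lemma matrix_eqI: "(\<And>x. A *v x = B *v x) \<Longrightarrow> A = (B :: real ^ 'n ^ 'm)"
  by (simp add: matrix_eq)

lemma inner_matrix_vector: "x \<bullet> (A *v y) = (transpose A *v x) \<bullet> (y :: real ^ 'n)"
  by (simp add: dot_lmul_matrix)

lemma inner_transpose: "transpose A \<bullet> transpose B = A \<bullet> (B :: real ^ 'n ^ 'm)"
  unfolding inner_vec_def transpose_def by (simp, subst sum.swap, simp)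

lemma norm_transpose: "norm (transpose A) = norm (A :: real ^ 'n ^ 'm)"
  by (simp add: norm_eq_sqrt_inner inner_transpose)

lemma inner_matrix_mult_left:
  fixes A :: "real ^ 'k ^ 'm" and B :: "real ^ 'n ^ 'k"
  shows "(A ** B) \<bullet> C = B \<bullet> (transpose A ** C)"
proof -
  have "(A ** B) \<bullet> C = (\<Sum>i\<in>UNIV. \<Sum>j\<in>UNIV. \<Sum>k\<in>UNIV. A$i$k * B$k$j * C$i$j)"
    by (simp add: inner_vec_def matrix_matrix_mult_def sum_distrib_right)
  also have "\<dots> = (\<Sum>i\<in>UNIV. \<Sum>k\<in>UNIV. \<Sum>j\<in>UNIV. A$i$k * B$k$j * C$i$j)"
    by (rule sum.cong[OF refl]) (rule sum.swap)
  also have "\<dots> = (\<Sum>k\<in>UNIV. \<Sum>i\<in>UNIV. \<Sum>j\<in>UNIV. A$i$k * B$k$j * C$i$j)"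
    by (rule sum.swap)
  also have "\<dots> = (\<Sum>k\<in>UNIV. \<Sum>j\<in>UNIV. \<Sum>i\<in>UNIV. A$i$k * B$k$j * C$i$j)"
    by (rule sum.cong[OF refl]) (rule sum.swap)
  also have "\<dots> = B \<bullet> (transpose A ** C)"
    by (simp add: inner_vec_def matrix_matrix_mult_def transpose_def sum_distrib_left algebra_simps)
  finally show ?thesis .
qed

lemma inner_matrix_mult_right:
  fixes A :: "real ^ 'k ^ 'm" and B :: "real ^ 'n ^ 'k"
  shows "(A ** B) \<bullet> C = A \<bullet> (C ** transpose B)"
proof -
  have "(A ** B) \<bullet> C = (transpose B ** transpose A) \<bullet> transpose C"
    by (metis inner_transpose matrix_transpose_mul)
  also have "\<dots> = transpose A \<bullet> (B ** transpose C)"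
    by (simp add: inner_matrix_mult_left)
  also have "\<dots> = A \<bullet> (C ** transpose B)"
    by (metis inner_transpose matrix_transpose_mul transpose_transpose)
  finally show ?thesis .
qed

lemma norm_matrix_vector_le: "norm (A *v x) \<le> norm A * norm (x :: real ^ 'n)"
proof -
  have "(norm (A *v x))\<^sup>2 = (\<Sum>i\<in>UNIV. (A$i \<bullet> x)\<^sup>2)"
    by (simp add: norm_vec_def L2_set_def sum_nonneg matrix_vector_mul_component)
  also have "\<dots> \<le> (\<Sum>i\<in>UNIV. (norm (A$i) * norm x)\<^sup>2)"
    by (intro sum_mono) (metis Cauchy_Schwarz_ineq2 abs_ge_zero power2_abs power_mono)
  also have "\<dots> = (norm A * norm x)\<^sup>2"
    by (simp add: norm_vec_def[of A] L2_set_def sum_nonneg power_mult_distrib sum_distrib_right)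
  finally show ?thesis
    by (rule power2_le_imp_le) simp
qed

lemma norm_matrix_mult_le:
  fixes A :: "real ^ 'k ^ 'm" and B :: "real ^ 'n ^ 'k"
  shows "norm (A ** B) \<le> norm A * norm B"
proof -
  have "(norm (A ** B))\<^sup>2 = (\<Sum>i\<in>UNIV. (norm ((A ** B)$i))\<^sup>2)"
    by (simp add: norm_vec_def[of "A ** B"] L2_set_def sum_nonneg)
  also have "\<dots> \<le> (\<Sum>i\<in>UNIV. (norm B * norm (A$i))\<^sup>2)"
  proof (intro sum_mono power_mono norm_ge_zero)
    fix i
    have "(A ** B)$i = transpose B *v (A$i)"
      by (simp add: matrix_matrix_mult_def matrix_vector_mult_def transpose_def vec_eq_iff mult.commute
          del: transpose_matrix_vector)
    then show "norm ((A ** B)$i) \<le> norm B * norm (A$i)"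
      using norm_matrix_vector_le[of "transpose B" "A$i"] by (simp add: norm_transpose del: transpose_matrix_vector)
  qed
  also have "\<dots> = (norm A * norm B)\<^sup>2"
    by (simp add: norm_vec_def[of A] L2_set_def sum_nonneg power_mult_distrib sum_distrib_left mult.commute)
  finally show ?thesis
    by (rule power2_le_imp_le) simp
qed

definition outer :: "real ^ 'n \<Rightarrow> real ^ 'n ^ 'n"
  where "outer x = (\<chi> i j. x $ i * x $ j)"

lemma transpose_outer [simp]: "transpose (outer x) = outer x"
  by (simp add: outer_def transpose_def vec_eq_iff mult.commute)

lemma outer_mult_vector: "outer x *v y = (x \<bullet> y) *\<^sub>R x"
  by (simp add: outer_def matrix_vector_mult_def vec_eq_iff inner_vec_def sum_distrib_left mult.assoc
      algebra_simps)

lemma inner_outer: "A \<bullet> outer x = x \<bullet> (A *v x)"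
  by (simp add: outer_def matrix_vector_mult_def inner_vec_def sum_distrib_left mult.commute mult.left_commute)

definition psd :: "real ^ 'n ^ 'n \<Rightarrow> bool"
  where "psd A \<longleftrightarrow> transpose A = A \<and> (\<forall>x. 0 \<le> x \<bullet> (A *v x))"

lemma psd_transpose: "psd A \<Longrightarrow> transpose A = A"
  and psd_nonneg: "psd A \<Longrightarrow> 0 \<le> x \<bullet> (A *v x)"
  by (simp_all add: psd_def)

lemma psd_zero [simp]: "psd 0"
  by (simp add: psd_def)

lemma psd_add: "psd A \<Longrightarrow> psd B \<Longrightarrow> psd (A + B)"
  by (simp add: psd_def transpose_add matrix_vector_arith inner_add_right)

lemma psd_scaleR: "psd A \<Longrightarrow> 0 \<le> c \<Longrightarrow> psd (c *\<^sub>R A)"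
  by (simp add: psd_def transpose_scalar matrix_vector_arith)

lemma psd_outer: "psd (outer x)"
  by (simp add: psd_def outer_mult_vector inner_commute)

lemma psd_congruence:
  fixes C :: "real ^ 'n ^ 'm"
  assumes "psd A" shows "psd (C ** A ** transpose C)"
  unfolding psd_def
proof (intro conjI allI)
  show "transpose (C ** A ** transpose C) = C ** A ** transpose C"
    using psd_transpose[OF assms] by (simp add: matrix_arith)
  show "0 \<le> x \<bullet> (C ** A ** transpose C *v x)" for x
    using psd_nonneg[OF assms, of "transpose C *v x"]
    by (simp add: inner_matrix_vector[of x C] del: transpose_matrix_vector flip: matrix_vector_mul_assoc)
qed

text \<open>The first-order condition at a minimum; the variational arguments for
  \<open>psd_null\<close> and \<open>pos_part_mult\<close> end here.\<close>

lemma linear_coeff_zero: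
  fixes a b :: real
  assumes "\<And>e. 0 \<le> 2 * e * a + e\<^sup>2 * b"
  shows "a = 0"
proof (rule ccontr)
  assume a: "a \<noteq> 0"
  \<comment> \<open>All that matters is \<open>0 < d\<close> and \<open>b < 2 * d\<close>: at
    \<open>e = - a / d\<close> the linear term then outweighs the quadratic one.\<close>
  define d where "d = \<bar>b\<bar> + 1"
  define e where "e = - a / d"
  have d: "0 < d" and ed: "e * d = - a" by (simp_all add: d_def e_def)
  have "0 \<le> (2 * e * a + e\<^sup>2 * b) * d\<^sup>2" using assms[of e] by simp
  also have "\<dots> = 2 * a * (e * d) * d + (e * d)\<^sup>2 * b" by (simp add: power2_eq_square algebra_simps)
  also have "\<dots> = a\<^sup>2 * (b - 2 * d)" unfolding ed by (simp add: power2_eq_square algebra_simps)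
  also have "\<dots> < 0" using a by (intro mult_pos_neg) (auto simp: d_def)
  finally show False by simp
qed

text \<open>The quadratic form is minimal at \<open>x\<close>, so its derivative in the direction
  \<open>A *v x\<close> vanishes.\<close>

lemma psd_null:
  assumes A: "psd A" and x: "x \<bullet> (A *v x) = 0"
  shows "A *v x = 0"
proof -
  define y where "y = A *v x"
  have yx: "x \<bullet> (A *v y) = y \<bullet> y"
    using psd_transpose[OF A] by (simp add: inner_matrix_vector[of x] y_def del: transpose_matrix_vector)
  have "0 \<le> 2 * e * (y \<bullet> y) + e\<^sup>2 * (y \<bullet> (A *v y))" for e
  proof -
    have "0 \<le> (x + e *\<^sub>R y) \<bullet> (y + e *\<^sub>R (A *v y))"
      using psd_nonneg[OF A, of "x + e *\<^sub>R y"] by (simp add: matrix_vector_arith y_def)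
    then show ?thesis
      using x yx by (simp add: inner_add_left inner_add_right y_def[symmetric] power2_eq_square algebra_simps)
  qed
  then have "y \<bullet> y = 0" by (rule linear_coeff_zero)
  then show ?thesis by (simp add: y_def)
qed

abbreviation psd_cone :: "(real ^ 'n ^ 'n) set" where "psd_cone \<equiv> {A. psd A}"

lemma closed_psd_cone: "closed psd_cone"
proof -
  have "linear (\<lambda>A. transpose A :: real ^ 'n ^ 'n)"
    by (rule linearI) (simp_all add: transpose_add transpose_scalar)
  then have "continuous_on UNIV (\<lambda>A. transpose A :: real ^ 'n ^ 'n)"
    unfolding linear_conv_bounded_linear by (rule linear_continuous_on)
  then have "closed {A :: real ^ 'n ^ 'n. transpose A = A}"
    by (intro closed_Collect_eq continuous_intros) auto
  moreover have "closed {A :: real ^ 'n ^ 'n. \<forall>x. 0 \<le> A \<bullet> outer x}"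
    by (intro closed_Collect_all closed_Collect_le continuous_intros)
  ultimately have "closed ({A :: real ^ 'n ^ 'n. transpose A = A} \<inter> {A. \<forall>x. 0 \<le> A \<bullet> outer x})"
    by (rule closed_Int)
  also have "\<dots> = psd_cone"
    by (auto simp: psd_def inner_outer)
  finally show ?thesis .
qed

lemma convex_psd_cone: "convex psd_cone"
  by (rule convexI) (auto intro: psd_add psd_scaleR)

section \<open>The positive part of a symmetric matrix and its complementary negative part\<close>

definition pos_part :: "real ^ 'n ^ 'n \<Rightarrow> real ^ 'n ^ 'n"
  where "pos_part S = closest_point psd_cone S"

lemma psd_pos_part: "psd (pos_part S)"
  using closest_point_in_set[OF closed_psd_cone, of S] psd_zero unfolding pos_part_def by blast

lemma pos_part_dot: "psd P \<Longrightarrow> 0 \<le> (pos_part S - S) \<bullet> (P - pos_part S)"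
  using closest_point_dot[OF convex_psd_cone closed_psd_cone, of P S]
  by (simp add: pos_part_def inner_diff_left)

text \<open>Conjugating the nearest point by \<open>mat 1 + e *\<^sub>R C\<close> stays in the cone
  for both signs of \<open>e\<close>. The first variation of the distance therefore vanishes for
  every \<open>C\<close>, which is the matrix equation.\<close>

lemma pos_part_mult:
  fixes S :: "real ^ 'n ^ 'n"
  assumes "transpose S = S"
  shows "(pos_part S - S) ** pos_part S = 0"
proof -
  define K where "K = pos_part S"
  define N where "N = K - S"
  have K: "psd K" by (simp add: K_def psd_pos_part)
  have N: "transpose N = N" using assms psd_transpose[OF K] by (simp add: N_def transpose_diff)
  have "N \<bullet> (C ** K) = 0" for C :: "real ^ 'n ^ 'n"
  proof -
    define a where "a = N \<bullet> (C ** K)"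
    define b where "b = N \<bullet> (C ** K ** transpose C)"
    have a': "N \<bullet> (K ** transpose C) = a"
      unfolding a_def by (metis K N inner_transpose matrix_transpose_mul psd_transpose)
    have q: "0 \<le> 2 * e * a + e\<^sup>2 * b" for e
    proof -
      have "psd ((mat 1 + e *\<^sub>R C) ** K ** transpose (mat 1 + e *\<^sub>R C))"
        by (rule psd_congruence[OF K])
      from pos_part_dot[OF this, of S]
      have "0 \<le> N \<bullet> (e *\<^sub>R (C ** K) + e *\<^sub>R (K ** transpose C) + (e*e) *\<^sub>R (C ** K ** transpose C))"
        by (simp add: matrix_arith K_def[symmetric] N_def[symmetric] algebra_simps)
      then show ?thesis
        by (simp add: inner_add_right a_def[symmetric] b_def[symmetric] a' power2_eq_square algebra_simps)
    qed
    from linear_coeff_zero[OF this] show ?thesis by (simp add: a_def)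
  qed
  then have "(N ** K) \<bullet> C = 0" for C
    by (metis K inner_commute inner_matrix_mult_right psd_transpose)
  then have "N ** K = 0" by (metis inner_eq_zero_iff)
  then show ?thesis by (simp add: N_def K_def)
qed

text \<open>Adding \<open>outer x\<close> to the nearest point stays in the cone; the obtuse-angle
  inequality for this competitor is the value of the form at \<open>x\<close>.\<close>

lemma psd_neg_part:
  assumes S: "transpose S = S"
  shows "psd (pos_part S - S)"
  unfolding psd_def
proof (intro conjI allI)
  show "transpose (pos_part S - S) = pos_part S - S"
    using S psd_transpose[OF psd_pos_part[of S]] by (simp add: transpose_diff)
  show "0 \<le> x \<bullet> ((pos_part S - S) *v x)" for x
    using pos_part_dot[OF psd_add[OF psd_pos_part psd_outer], of S S x] by (simp add: inner_outer)
qed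

text \<open>Self-duality of the cone, without square roots: the positive part \<open>K\<close> of
  \<open>- Q\<close> satisfies \<open>K ** K = - (Q ** K)\<close>, and comparing signs forces
  \<open>K = 0\<close>. The obtuse-angle inequality at the nearest point 0 is then the
  claim.\<close>

lemma psd_inner_nonneg:
  assumes P: "psd P" and Q: "psd Q"
  shows "0 \<le> P \<bullet> Q"
proof -
  define K where "K = pos_part (- Q)"
  have K: "psd K" by (simp add: K_def psd_pos_part)
  have "(K + Q) ** K = 0"
    using pos_part_mult[of "- Q"] psd_transpose[OF Q] by (simp add: K_def transpose_minus)
  then have KK: "K ** K = - (Q ** K)" by (simp add: matrix_arith add_eq_0_iff)
  have "K *v x = 0" for x
  proof -
    define y where "y = K *v x"
    have "y \<bullet> (K *v y) = x \<bullet> (K *v (K *v y))"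
      using psd_transpose[OF K] by (simp add: inner_matrix_vector[of x] y_def del: transpose_matrix_vector)
    also have "K *v (K *v y) = - (transpose (Q ** K) *v y)"
      using KK psd_transpose[OF K] by (metis matrix_transpose_mul matrix_vector_minus_left matrix_vector_mul_assoc transpose_minus)
    also have "x \<bullet> \<dots> = - (y \<bullet> (Q *v y))"
      using psd_transpose[OF K] psd_transpose[OF Q]
      by (simp add: matrix_transpose_mul inner_matrix_vector[of x K] y_def
          del: transpose_matrix_vector flip: matrix_vector_mul_assoc)
    finally have "y \<bullet> (K *v y) = 0"
      using psd_nonneg[OF K, of y] psd_nonneg[OF Q, of y] by linarith
    then have "K *v y = 0" by (rule psd_null[OF K])
    then have "y \<bullet> y = 0"
      using psd_transpose[OF K] by (simp add: inner_matrix_vector[of _ K] y_def del: transpose_matrix_vector)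
    then show ?thesis by (simp add: y_def)
  qed
  then have "K = 0" by (intro matrix_eqI) simp
  then show ?thesis using pos_part_dot[OF P, of "- Q"] by (simp add: K_def inner_commute)
qed

text \<open>The squared distance from \<open>K - N\<close> to \<open>P\<close> is |N|^2 + |K - P|^2
  + 2 * (N, P), and self-duality makes the last term nonnegative.\<close>

lemma pos_part_unique:
  assumes K: "psd K" and N: "psd N" and KN: "K \<bullet> N = 0"
  shows "pos_part (K - N) = K"
proof -
  have "dist (K - N) K \<le> dist (K - N) P" if "psd P" for P
  proof -
    have "(norm (K - N - P))\<^sup>2 = (norm N)\<^sup>2 + (norm (K - P))\<^sup>2 + 2 * (N \<bullet> P)"
      using KN by (simp add: power2_norm_eq_inner inner_diff_left inner_diff_right inner_commute)
    also have "\<dots> \<ge> (norm N)\<^sup>2"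
      using psd_inner_nonneg[OF N that] by simp
    finally have "norm N \<le> norm (K - N - P)"
      by (rule power2_le_imp_le) simp
    then show ?thesis by (simp add: dist_norm)
  qed
  then show ?thesis
    unfolding pos_part_def using closest_point_unique[OF convex_psd_cone closed_psd_cone, of K "K - N"] K
    by auto
qed

lemma pos_part_inner_neg_part:
  assumes "transpose S = S" shows "pos_part S \<bullet> (pos_part S - S) = 0"
proof -
  have "pos_part S \<bullet> (pos_part S - S) = (mat 1 ** pos_part S) \<bullet> (pos_part S - S)" by simp
  also have "\<dots> = mat 1 \<bullet> ((pos_part S - S) ** pos_part S)"
    by (simp add: inner_matrix_mult_right psd_transpose[OF psd_pos_part] del: matrix_mul_lid)
  finally show ?thesis by (simp add: pos_part_mult[OF assms])
qed

lemma pos_part_uminus: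
  assumes "transpose S = S" shows "pos_part (- S) = pos_part S - S"
  using pos_part_unique[OF psd_neg_part[OF assms] psd_pos_part, of S] pos_part_inner_neg_part[OF assms]
  by (simp add: inner_commute)

text \<open>Conjugation by \<open>g\<close> preserves the cone and the inner product, so it carries
  the decomposition into positive and negative part to one of the same kind.\<close>

lemma pos_part_orthogonal:
  fixes g :: "real ^ 'n ^ 'n"
  assumes S: "transpose S = S" and g: "orthogonal_matrix g"
  shows "pos_part (g ** S ** transpose g) = g ** pos_part S ** transpose g"
proof -
  have gg: "transpose g ** g = mat 1" using g by (simp add: orthogonal_matrix_def)
  let ?K = "g ** pos_part S ** transpose g" and ?N = "g ** (pos_part S - S) ** transpose g"
  have "?K \<bullet> ?N = pos_part S \<bullet> (transpose g ** ?N ** g)"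
    by (simp add: inner_matrix_mult_right[of _ "transpose g"] inner_matrix_mult_left[of g] matrix_mul_assoc)
  also have "transpose g ** ?N ** g = (transpose g ** g) ** (pos_part S - S) ** (transpose g ** g)"
    by (simp only: matrix_mul_assoc)
  finally have "?K \<bullet> ?N = 0"
    using pos_part_inner_neg_part[OF S] gg by simp
  from pos_part_unique[OF psd_congruence[OF psd_pos_part] psd_congruence[OF psd_neg_part[OF S]] this]
  show ?thesis by (simp add: matrix_arith)
qed

text \<open>In the expansion of |(K - L) - (M - N)|^2 the cross term has the favourable sign, by
  complementarity and self-duality. Keeping both squares is what later yields the factor sqrt
  2.\<close>

lemma pos_part_norm_diff:
  assumes S: "transpose S = S" and T: "transpose T = T"
  shows "(norm (pos_part S - pos_part T))\<^sup>2 + (norm ((pos_part S - S) - (pos_part T - T)))\<^sup>2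
    \<le> (norm (S - T))\<^sup>2"
proof -
  define K L M N where "K = pos_part S" and "L = pos_part T" and "M = pos_part S - S" and "N = pos_part T - T"
  have ST: "S - T = (K - L) - (M - N)" by (simp add: K_def L_def M_def N_def)
  have "K \<bullet> M = 0" "L \<bullet> N = 0"
    using pos_part_inner_neg_part S T by (auto simp: K_def L_def M_def N_def)
  moreover have "0 \<le> K \<bullet> N" "0 \<le> L \<bullet> M"
    using S T by (auto simp: K_def L_def M_def N_def intro: psd_inner_nonneg psd_pos_part psd_neg_part)
  ultimately have "(K - L) \<bullet> (M - N) \<le> 0"
    by (simp add: inner_diff_left inner_diff_right)
  then have "(norm (K - L))\<^sup>2 + (norm (M - N))\<^sup>2 \<le> (norm (S - T))\<^sup>2"
    unfolding ST power2_norm_eq_inner inner_diff_left[of "K - L" "M - N"] inner_diff_right[of _ "K - L" "M - N"]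
    by (simp add: inner_commute)
  then show ?thesis by (simp add: K_def L_def M_def N_def)
qed

section \<open>Projections onto ranges\<close>

text \<open>The equations \<open>P ** K = K\<close> and \<open>P = K ** L\<close> encode the two
  inclusions between the ranges, so that later arguments stay within matrix algebra.\<close>

definition is_range_proj :: "real ^ 'n ^ 'n \<Rightarrow> real ^ 'n ^ 'n \<Rightarrow> bool"
  where "is_range_proj P K \<longleftrightarrow> transpose P = P \<and> P ** P = P \<and> P ** K = K \<and> (\<exists>L. P = K ** L)"

lemma is_range_projD:
  assumes "is_range_proj P K"
  shows "transpose P = P" "P ** P = P" "P ** K = K"
  using assms by (auto simp: is_range_proj_def)

text \<open>Sum the rank-one projections of an orthonormal basis of the range. The value of
  \<open>P \<bullet> P\<close> is recorded because projections of equal rank then have equal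
  norm.\<close>

lemma range_proj_exists_inner: "\<exists>P. is_range_proj P (K :: real ^ 'n ^ 'n) \<and> P \<bullet> P = rank K"
proof -
  have "subspace (range ((*v) K))"
    by (intro linear_subspace_image) auto
  then obtain B where B: "B \<subseteq> range ((*v) K)" "pairwise orthogonal B" "\<And>x. x \<in> B \<Longrightarrow> norm x = 1"
    "independent B" "span B = range ((*v) K)"
    using orthonormal_basis_subspace by metis
  have fin: "finite B" using B(4) by (simp add: independent_imp_finite)
  have Bb: "b \<bullet> c = (if b = c then 1 else 0)" if "b \<in> B" "c \<in> B" for b c
    using B(2,3) that by (auto simp: pairwise_def orthogonal_def dot_square_norm)
  define P where "P = (\<Sum>b\<in>B. outer b)"
  have P: "P *v x = (\<Sum>b\<in>B. (b \<bullet> x) *\<^sub>R b)" for x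
    unfolding P_def using fin by induction (auto simp: matrix_vector_arith outer_mult_vector)
  have PB: "P *v b = b" if "b \<in> B" for b
    using that fin by (simp add: P Bb if_distrib[of "\<lambda>c. c *\<^sub>R _"] cong: if_cong sum.cong)
  have Pspan: "P *v x = x" if "x \<in> span B" for x
    using that by (induction rule: span_induct_alt) (auto simp: matrix_vector_arith PB)
  have T: "transpose P = P"
    unfolding P_def using fin by induction (auto simp: transpose_add)
  have PK: "P ** K = K"
    by (rule matrix_eqI) (use Pspan B(5) in \<open>auto simp flip: matrix_vector_mul_assoc\<close>)
  obtain c where c: "\<And>b. b \<in> B \<Longrightarrow> b = K *v c b" using B(1) by (metis image_iff subset_iff)
  \<comment> \<open>\<open>L\<close> sends each basis vector \<open>b\<close> to a chosen preimage
    \<open>c b\<close> under \<open>K\<close> and kills the orthogonal complement of the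
    range.\<close>
  define L where "L = (\<Sum>b\<in>B. (\<chi> i j. c b $ i * b $ j))"
  have L1: "(\<chi> i j. c b $ i * b $ j) *v x = (b \<bullet> x) *\<^sub>R c b" for b x
    by (simp add: matrix_vector_mult_def vec_eq_iff inner_vec_def sum_distrib_left algebra_simps)
  have L: "L *v x = (\<Sum>b\<in>B. (b \<bullet> x) *\<^sub>R c b)" for x
    unfolding L_def using fin by induction (auto simp: matrix_vector_arith L1)
  have "P = K ** L"
  proof (rule matrix_eqI)
    fix x
    have "K *v (L *v x) = (\<Sum>b\<in>B. (b \<bullet> x) *\<^sub>R (K *v c b))"
      unfolding L by (simp add: linear_sum[OF matrix_vector_mul_linear] matrix_vector_arith)
    also have "\<dots> = P *v x" unfolding P by (rule sum.cong) (use c in auto)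
    finally show "P *v x = (K ** L) *v x" by (simp flip: matrix_vector_mul_assoc)
  qed
  moreover have "P ** P = P"
    by (metis PK calculation matrix_mul_assoc)
  moreover have "P \<bullet> P = rank K"
  proof -
    have "P \<bullet> P = (\<Sum>b\<in>B. P \<bullet> outer b)" by (subst (2) P_def) (simp add: inner_sum_right)
    also have "\<dots> = (\<Sum>b\<in>B. 1)"
      by (rule sum.cong) (use PB B(3) in \<open>auto simp: inner_outer dot_square_norm\<close>)
    also have "\<dots> = card B" by simp
    also have "card B = dim (range ((*v) K))"
      using B(4,5) by (metis dim_span_eq_card_independent dim_span)
    finally show ?thesis by (simp add: rank_dim_range)
  qed
  ultimately show ?thesis using T PK unfolding is_range_proj_def by blast
qed

lemma range_proj_exists: "\<exists>P. is_range_proj P (K :: real ^ 'n ^ 'n)"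
  using range_proj_exists_inner by blast

lemma range_proj_unique:
  assumes "is_range_proj P K" "is_range_proj Q K"
  shows "P = Q"
proof -
  have *: "Q ** P = P" if "is_range_proj P K" "is_range_proj Q K" for P Q
    using that unfolding is_range_proj_def by (metis matrix_mul_assoc)
  have "P = transpose (Q ** P)" using *[OF assms] is_range_projD(1)[OF assms(1)] by simp
  also have "\<dots> = P ** Q" using assms by (simp add: matrix_transpose_mul is_range_projD)
  also have "\<dots> = Q" using *[OF assms(2,1)] .
  finally show ?thesis .
qed

lemma range_proj_rank: "is_range_proj P K \<Longrightarrow> rank P = rank K"
  unfolding is_range_proj_def by (metis le_antisym rank_mul_le_left)

lemma range_proj_mult_right:
  assumes "is_range_proj P K" "transpose K = K" shows "K ** P = K"
  by (metis assms is_range_projD(1,3) matrix_transpose_mul)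

lemma range_proj_null:
  assumes "is_range_proj P K" "transpose K = K"
  shows "K *v x = 0 \<longleftrightarrow> P *v x = 0"
proof
  obtain L where L: "P = K ** L" using assms(1) by (auto simp: is_range_proj_def)
  assume "K *v x = 0"
  moreover have "P = transpose L ** K"
    by (metis L assms is_range_projD(1) matrix_transpose_mul)
  ultimately show "P *v x = 0" by (simp flip: matrix_vector_mul_assoc)
next
  assume "P *v x = 0"
  then show "K *v x = 0"
    by (metis range_proj_mult_right[OF assms] matrix_vector_mul_assoc matrix_vector_mult_0_right)
qed

lemma range_proj_orthogonal_conj:
  fixes g :: "real ^ 'n ^ 'n"
  assumes "is_range_proj P K" "orthogonal_matrix g"
  shows "is_range_proj (g ** P ** transpose g) (g ** K ** transpose g)"
proof -
  have g: "transpose g ** g = mat 1" using assms(2) by (simp add: orthogonal_matrix_def)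
  have c: "(g ** M ** transpose g) ** (g ** N ** transpose g) = g ** (M ** N) ** transpose g" for M N
    by (metis g matrix_mul_assoc matrix_mul_rid)
  obtain L where "P = K ** L" using assms(1) by (auto simp: is_range_proj_def)
  then have "\<exists>M. g ** P ** transpose g = (g ** K ** transpose g) ** M"
    by (metis c)
  moreover have "transpose (g ** P ** transpose g) = g ** P ** transpose g"
    by (simp add: matrix_transpose_mul matrix_mul_assoc is_range_projD(1)[OF assms(1)])
  ultimately show ?thesis
    unfolding is_range_proj_def c is_range_projD(2,3)[OF assms(1)] by blast
qed

lemma range_proj_inner_self: "is_range_proj P K \<Longrightarrow> P \<bullet> P = rank K"
  using range_proj_exists_inner range_proj_unique by metis

text \<open>With \<open>R = mat 1 - P'\<close>, equality of the ranks gives |P' - P|^2 = 2 * |R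
  P|^2, and \<open>R ** K' = 0\<close> turns \<open>R ** P\<close> into
  \<open>R ** (K - K') ** L\<close>. The constant depends only on the base point, through
  \<open>L\<close> and the rank.\<close>

lemma range_proj_lipschitz_at:
  fixes K :: "real ^ 'n ^ 'n"
  assumes P: "is_range_proj P K" and K: "transpose K = K"
  obtains C where "0 < C"
    "\<And>K' P'. is_range_proj P' K' \<Longrightarrow> transpose K' = K' \<Longrightarrow> rank K' = rank K \<Longrightarrow>
       norm (P' - P) \<le> C * norm (K' - K)"
proof -
  obtain L where L: "P = K ** L" using P by (auto simp: is_range_proj_def)
  define C where "C = 2 * ((norm (mat 1 :: real ^ 'n ^ 'n) + rank K) * norm L) + 1"
  show ?thesis
  proof (rule that)
    show "0 < C" by (auto simp: C_def intro!: add_nonneg_pos)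
    fix K' P' :: "real ^ 'n ^ 'n"
    assume P': "is_range_proj P' K'" and K': "transpose K' = K'" and r: "rank K' = rank K"
    define R where "R = mat 1 - P'"
    have R: "transpose R = R" "R ** R = R" "R ** K' = 0"
      using is_range_projD[OF P'] by (simp_all add: R_def matrix_arith)
    have RP: "R ** P = R ** (K - K') ** L"
      unfolding L using R(3) by (simp add: matrix_arith)
    have "(norm P')\<^sup>2 = rank K" using range_proj_inner_self[OF P'] r by (simp add: power2_norm_eq_inner)
    also have "\<dots> \<le> (real (rank K))\<^sup>2"
      by (cases "rank K = 0") (auto simp: power2_eq_square)
    finally have "norm P' \<le> rank K" by (rule power2_le_imp_le) simp
    then have nR: "norm R \<le> norm (mat 1 :: real ^ 'n ^ 'n) + rank K"
      using norm_triangle_ineq4[of "mat 1" P'] by (simp add: R_def)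
    have "norm (R ** P) \<le> norm R * norm (K - K') * norm L"
      unfolding RP by (meson norm_matrix_mult_le mult_right_mono norm_ge_zero order_trans)
    also have "\<dots> \<le> (norm (mat 1 :: real ^ 'n ^ 'n) + rank K) * norm (K - K') * norm L"
      by (intro mult_right_mono nR) auto
    finally have nRP: "2 * norm (R ** P) \<le> C * norm (K' - K)"
      unfolding C_def norm_minus_commute[of K'] distrib_right using norm_ge_zero[of "K - K'"]
      by (simp add: algebra_simps del: norm_ge_zero)
    have "(R ** P) \<bullet> (R ** P) = P \<bullet> (R ** P)"
      by (simp add: inner_matrix_mult_left[of R] R matrix_mul_assoc)
    also have "\<dots> = P \<bullet> P - P \<bullet> (P' ** P)"
      by (simp add: R_def matrix_arith inner_diff_right)
    also have "P \<bullet> (P' ** P) = P \<bullet> P'"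
      by (simp add: inner_commute[of P] inner_matrix_mult_right is_range_projD[OF P])
    finally have "(norm (P' - P))\<^sup>2 = 2 * (norm (R ** P))\<^sup>2"
      using range_proj_inner_self[OF P'] range_proj_inner_self[OF P] r
      by (simp add: power2_norm_eq_inner inner_diff_left inner_diff_right inner_commute)
    also have "\<dots> \<le> (2 * norm (R ** P))\<^sup>2" by (simp add: power_mult_distrib)
    finally have "norm (P' - P) \<le> 2 * norm (R ** P)" by (rule power2_le_imp_le) simp
    with nRP show "norm (P' - P) \<le> C * norm (K' - K)" by linarith
  qed
qed

text \<open>Since \<open>v\<close> and \<open>a\<close> are null vectors of the quadratic form \<open>x \<bullet> (J *v x)\<close>, each has equally long
  components in both eigenspaces of \<open>J\<close>; the Cauchy-Schwarz inequality is applied to the components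
  in the \<open>s\<close>-eigenspace.\<close>

lemma isotropic_combination_zero:
  fixes J :: "real ^ 'n ^ 'n"
  assumes J: "transpose J = J" "J ** J = mat 1"
    and v: "v \<bullet> (J *v v) = 0" and a: "a \<bullet> (J *v a) = 0" and va: "v \<bullet> a = a \<bullet> a"
    and t: "0 < t" "t \<le> 1" and s: "s = 1 \<or> s = - 1"
    and e: "e = (1 - t) *\<^sub>R a + t *\<^sub>R v" "J *v e = s *\<^sub>R e"
  shows "v = 0"
proof -
  have adj: "x \<bullet> (J *v y) = (J *v x) \<bullet> y" for x y
    using J(1) by (metis inner_matrix_vector)
  note adj' = adj[symmetric]
  have JJ': "J *v (J *v x) = x" for x
    by (simp add: J(2) matrix_vector_mul_assoc)
  define A N w where "A = a \<bullet> a" and "N = v \<bullet> v" and "w = v \<bullet> (J *v a)"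
  have w': "a \<bullet> (J *v v) = w" unfolding w_def by (metis adj inner_commute)
  \<comment> \<open>The eigenvector equation is tested first against \<open>a\<close> and then
    against \<open>e\<close> itself; together these determine \<open>t * w\<close> and the ratio of
    the norms of \<open>v\<close> and \<open>a\<close>.\<close>
  have "e \<bullet> (J *v a) = s * (e \<bullet> a)" by (simp add: adj e(2))
  then have tw: "t * w = s * A"
    using a va by (simp add: e(1) inner_add_left w_def[symmetric] A_def[symmetric] algebra_simps)
  have "e \<bullet> (J *v e) = s * (e \<bullet> e)" by (simp add: e(2))
  moreover have "e \<bullet> (J *v e) = 2 * (1 - t) * (t * w)"
    using v a w' by (simp add: e(1) matrix_vector_arith inner_add_left inner_add_right
        w_def[symmetric] algebra_simps)
  moreover have "e \<bullet> e = (1 - t)\<^sup>2 * A + 2 * (1 - t) * t * A + t\<^sup>2 * N"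
    using va by (simp add: e(1) inner_add_left inner_add_right inner_commute[of a v]
        A_def[symmetric] N_def[symmetric] power2_eq_square algebra_simps)
  ultimately have "s * (2 * (1 - t) * A) = s * ((1 - t)\<^sup>2 * A + 2 * (1 - t) * t * A + t\<^sup>2 * N)"
    unfolding tw by (simp add: mult.left_commute)
  then have "2 * (1 - t) * A = (1 - t)\<^sup>2 * A + 2 * (1 - t) * t * A + t\<^sup>2 * N"
    using s by auto
  then have tN: "t\<^sup>2 * N = (1 - t)\<^sup>2 * A" by (simp add: power2_eq_square algebra_simps)
  have "(t * norm v)\<^sup>2 = ((1 - t) * norm a)\<^sup>2"
    using tN by (simp add: power_mult_distrib A_def N_def power2_norm_eq_inner)
  then have tv: "t * norm v = (1 - t) * norm a" using t by (simp add: power2_eq_iff_nonneg)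
  define x y where "x = v + s *\<^sub>R (J *v v)" and "y = a + s *\<^sub>R (J *v a)"
  have "x \<bullet> x = 2 * N" "y \<bullet> y = 2 * A"
    using v a s by (auto simp: x_def y_def inner_add_left inner_add_right inner_diff_left
        inner_diff_right N_def A_def JJ' adj')
  then have nxy: "norm x = sqrt 2 * norm v" "norm y = sqrt 2 * norm a"
    by (simp_all add: norm_eq_sqrt_inner N_def A_def real_sqrt_mult)
  have "2 * (A + s * w) = x \<bullet> y"
    using va w' s by (auto simp: x_def y_def inner_add_left inner_add_right inner_diff_left
        inner_diff_right w_def A_def JJ' adj')
  also have "\<dots> \<le> 2 * (norm v * norm a)"
    using norm_cauchy_schwarz[of x y] by (simp add: nxy algebra_simps)
  \<comment> \<open>After multiplication by \<open>t\<close> the inequality becomes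
    \<open>t * A + A \<le> (1 - t) * A\<close>, so \<open>A\<close> cannot be positive.\<close>
  finally have "t * (A + s * w) \<le> t * (norm v * norm a)"
    using t by simp
  moreover have "t * (s * w) = A" using tw s by auto
  moreover have "t * (norm v * norm a) = (1 - t) * A"
    using tv by (simp add: A_def dot_square_norm power2_eq_square flip: mult.assoc)
  ultimately have "2 * (t * A) \<le> 0" by (simp add: algebra_simps)
  then have "A \<le> 0" using t by (simp add: mult_le_0_iff)
  moreover have "0 \<le> A" by (simp add: A_def)
  ultimately have "A = 0" by linarith
  then have "t\<^sup>2 * N = 0" using tN by simp
  then show ?thesis using t by (simp add: N_def)
qed

section \<open>Symmetric matrices that are odd with respect to a grading\<close>

lemma psd_add_null: "psd A \<Longrightarrow> psd B \<Longrightarrow> (A + B) *v x = 0 \<Longrightarrow> A *v x = 0 \<and> B *v x = 0"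
proof -
  assume A: "psd A" and B: "psd B" and x: "(A + B) *v x = 0"
  have "x \<bullet> (A *v x) + x \<bullet> (B *v x) = 0"
    using x by (metis inner_add_right inner_zero_right matrix_vector_mult_add_rdistrib)
  then have "x \<bullet> (A *v x) = 0" "x \<bullet> (B *v x) = 0"
    using psd_nonneg[OF A, of x] psd_nonneg[OF B, of x] by linarith+
  then show ?thesis using psd_null A B by blast
qed

text \<open>A symmetric matrix has the orthogonal complement of its kernel as range. In terms of
  range projections, equal kernels give \<open>P ** Q = P\<close>.\<close>

lemma rank_cong_null:
  fixes A B :: "real ^ 'n ^ 'n"
  assumes "\<And>x. A *v x = 0 \<longleftrightarrow> B *v x = 0" "transpose A = A" "transpose B = B"
  shows "rank A = rank B"
proof -
  have *: "rank A \<le> rank B" if "\<And>x. A *v x = 0 \<longleftrightarrow> B *v x = 0" "transpose A = A" "transpose B = B"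
    for A B :: "real ^ 'n ^ 'n"
  proof -
    obtain P Q where PQ: "is_range_proj P A" "is_range_proj Q B"
      using range_proj_exists by metis
    have "P ** Q = P"
    proof (rule matrix_eqI)
      fix x
      have "Q *v (x - Q *v x) = 0"
        using is_range_projD(2)[OF PQ(2)] by (simp add: matrix_vector_arith matrix_vector_mul_assoc)
      then have "P *v (x - Q *v x) = 0"
        using that range_proj_null PQ by metis
      then show "P ** Q *v x = P *v x" by (simp add: matrix_vector_arith matrix_vector_mul_assoc)
    qed
    then have "rank P \<le> rank Q" by (metis rank_mul_le_right)
    then show ?thesis using PQ by (simp add: range_proj_rank)
  qed
  show ?thesis using *[of A B] *[of B A] assms by (simp add: le_antisym)
qed

lemma orthogonal_commute_iff:
  fixes g S :: "real ^ 'n ^ 'n"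
  assumes "orthogonal_matrix g" shows "g ** S ** transpose g = S \<longleftrightarrow> g ** S = S ** g"
  using assms unfolding orthogonal_matrix_def by (metis matrix_mul_assoc matrix_mul_rid)

text \<open>Both signs in \<open>G_J\<close> occur: the complex structure preserves the two blocks
  of the grading, whereas the matrix that encodes (skew-)symmetry exchanges them.\<close>

locale graded_symmetry =
  fixes J :: "real ^ 'h ^ 'h" and G :: "(real ^ 'h ^ 'h) set"
  assumes J_sym: "transpose J = J" and J_inv: "J ** J = mat 1"
    and G_orthogonal: "g \<in> G \<Longrightarrow> orthogonal_matrix g"
    and G_J: "g \<in> G \<Longrightarrow> g ** J = J ** g \<or> g ** J = - (J ** g)"
begin

definition odd_mats :: "(real ^ 'h ^ 'h) set"
  where "odd_mats = {S. transpose S = S \<and> J ** S ** J = - S \<and> (\<forall>g\<in>G. g ** S = S ** g)}"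

definition stratum :: "nat \<Rightarrow> (real ^ 'h ^ 'h) set"
  where "stratum k = {S \<in> odd_mats. rank S = k}"

text \<open>Recovers an odd matrix from its positive part; being linear, it carries segments and
  polynomial curves of positive parts over to the stratum.\<close>

definition antipart :: "real ^ 'h ^ 'h \<Rightarrow> real ^ 'h ^ 'h"
  where "antipart K = K - J ** K ** J"

lemma antipart_arith: "antipart (K + L) = antipart K + antipart L" "antipart (K - L) = antipart K - antipart L"
  "antipart (c *\<^sub>R K) = c *\<^sub>R antipart K"
  by (simp_all add: antipart_def matrix_arith algebra_simps)

lemma J_orthogonal: "orthogonal_matrix J"
  by (simp add: orthogonal_matrix_def J_sym J_inv)

lemma norm_J: "norm (J ** K ** J) = norm K"
proof -
  have "(J ** K ** J) \<bullet> (J ** K ** J) = K \<bullet> ((J ** J) ** K ** (J ** J))"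
    by (simp add: inner_matrix_mult_right[of "J ** K" J] inner_matrix_mult_left[of J K] J_sym matrix_mul_assoc)
  then show ?thesis by (simp add: norm_eq_sqrt_inner J_inv)
qed

lemma norm_antipart_le: "norm (antipart K) \<le> 2 * norm K"
  using norm_triangle_ineq4[of K "J ** K ** J"] by (simp add: antipart_def norm_J)

lemma JJ_vector [simp]: "J *v (J *v x) = x"
  by (simp add: matrix_vector_mul_assoc J_inv)

text \<open>The last two conditions say that the range of \<open>K\<close> contains no nonzero eigenvector of \<open>J\<close>.\<close>

definition admissible :: "real ^ 'h ^ 'h \<Rightarrow> bool"
  where "admissible K \<longleftrightarrow> psd K \<and> (\<forall>g\<in>G. g ** K = K ** g) \<and>
    (\<forall>x. J *v (K *v x) = K *v x \<longrightarrow> K *v x = 0) \<and> (\<forall>x. J *v (K *v x) = - (K *v x) \<longrightarrow> K *v x = 0)"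

lemma antipart_odd:
  assumes "transpose K = K" "\<And>g. g \<in> G \<Longrightarrow> g ** K = K ** g"
  shows "antipart K \<in> odd_mats"
  unfolding odd_mats_def
proof (intro CollectI conjI ballI)
  show "transpose (antipart K) = antipart K"
    by (simp add: antipart_def matrix_arith J_sym assms(1))
  have "J ** (J ** K ** J) ** J = (J ** J) ** K ** (J ** J)" by (simp add: matrix_mul_assoc)
  then have "J ** (J ** K ** J) ** J = K" by (simp add: J_inv)
  then show "J ** antipart K ** J = - antipart K"
    by (simp add: antipart_def matrix_diff_ldistrib matrix_diff_rdistrib)
  fix g assume g: "g \<in> G"
  have "g ** J ** K ** J = J ** K ** J ** g"
  proof (cases "g ** J = J ** g")
    case True
    then show ?thesis using assms(2)[OF g] by (metis matrix_mul_assoc)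
  next
    \<comment> \<open>Moving \<open>g\<close> past the two factors \<open>J\<close> produces two
      signs, which cancel.\<close>
    case False
    then have "g ** J = - (J ** g)" using G_J[OF g] by blast
    then have "g ** J ** K ** J = - (J ** K ** (g ** J))"
      using assms(2)[OF g] by (metis matrix_mul_assoc matrix_minus_left)
    then show ?thesis using \<open>g ** J = - (J ** g)\<close> by (simp add: matrix_arith)
  qed
  then show "g ** antipart K = antipart K ** g"
    using assms(2)[OF g] by (simp add: antipart_def matrix_arith)
qed

text \<open>The range \<open>E\<close> of \<open>K\<close> meets \<open>J E\<close> only in 0: if
  \<open>K x = J (K y)\<close>, then \<open>J\<close> swaps \<open>K x\<close> and
  \<open>K y\<close>, so their sum and difference are eigenvectors. \<open>antipart K\<close> maps
  into \<open>E + J E\<close> and is injective there.\<close>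

lemma rank_antipart:
  assumes K: "admissible K"
  shows "rank (antipart K) = 2 * rank K"
proof -
  have sym: "transpose K = K" using K by (simp add: admissible_def psd_transpose)
  have pm: "K *v x = 0" if "J *v (K *v x) = K *v x \<or> J *v (K *v x) = - (K *v x)" for x
    using K that by (auto simp: admissible_def)
  have meet: "K *v x = 0 \<and> K *v y = 0" if "K *v x = J *v (K *v y)" for x y
  proof -
    have J: "J *v (K *v x) = K *v y" using that by simp
    have "K *v (x + y) = 0"
      by (rule pm) (use that J in \<open>simp add: matrix_vector_arith\<close>)
    moreover have "K *v (x - y) = 0"
      by (rule pm) (use that J in \<open>simp add: matrix_vector_arith\<close>)
    ultimately have "K *v x + K *v y = 0" "K *v x = K *v y" by (simp_all add: matrix_vector_arith)
    then show ?thesis by (simp flip: scaleR_2)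
  qed
  define E where "E = range ((*v) K)"
  define F where "F = (*v) J ` E"
  define U where "U = {x + y | x y. x \<in> E \<and> y \<in> F}"
  have subE: "subspace E" unfolding E_def by (intro linear_subspace_image) auto
  then have subF: "subspace F" unfolding F_def by (intro linear_subspace_image) auto
  have "inj ((*v) J)" by (rule inj_on_inverseI[where g = "(*v) J"]) simp
  then have dimF: "dim F = dim E"
    unfolding F_def by (intro dim_image_eq) (auto intro: inj_on_subset)
  have "E \<inter> F = {0}"
    using meet subspace_0[OF subE] subspace_0[OF subF] by (auto simp: E_def F_def)
  then have dimU: "dim U = 2 * rank K"
    using dim_sums_Int[OF subE subF] dimF by (simp add: U_def rank_dim_range E_def)
  have subU: "subspace U" unfolding U_def by (rule subspace_sums[OF subE subF])
  have app: "antipart K *v x = K *v x - J *v (K *v (J *v x))" for x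
    by (simp add: antipart_def matrix_vector_arith flip: matrix_vector_mul_assoc)
  have "antipart K *v x \<in> U" for x
    unfolding U_def E_def F_def app
    by (rule CollectI, rule exI[of _ "K *v x"], rule exI[of _ "J *v (K *v (- (J *v x)))"])
       (simp add: matrix_vector_minus_right, metis imageI matrix_vector_minus_right rangeI)
  then have le: "rank (antipart K) \<le> 2 * rank K"
    unfolding rank_dim_range dimU[unfolded rank_dim_range, symmetric] by (intro dim_subset) auto
  \<comment> \<open>A null vector of \<open>antipart K\<close> is orthogonal to both
    \<open>E\<close> and \<open>J E\<close>; if it lies in their sum, it is orthogonal to
    itself.\<close>
  have inj: "x = 0" if x: "x \<in> U" and z: "antipart K *v x = 0" for x
  proof -
    obtain a b where ab: "x = K *v a + J *v (K *v b)" using x by (auto simp: U_def E_def F_def)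
    have "K *v x = 0" "K *v (J *v x) = 0" using meet[of x "J *v x"] z by (auto simp: app)
    then have "x \<bullet> (K *v a) = 0" "x \<bullet> (J *v (K *v b)) = 0"
      using sym J_sym by (metis inner_matrix_vector inner_zero_left)+
    then have "x \<bullet> x = 0" by (subst (2) ab) (simp add: inner_add_right)
    then show ?thesis by simp
  qed
  have "inj_on ((*v) (antipart K)) U"
  proof (rule inj_onI)
    fix x y assume "x \<in> U" "y \<in> U" "antipart K *v x = antipart K *v y"
    then show "x = y"
      using inj[of "x - y"] subspace_diff[OF subU] by (simp add: matrix_vector_arith)
  qed
  then have "dim ((*v) (antipart K) ` U) = dim U"
    using subU by (intro dim_image_eq) (auto simp: span_eq_iff[THEN iffD2])
  moreover have "dim ((*v) (antipart K) ` U) \<le> rank (antipart K)"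
    unfolding rank_dim_range by (intro dim_subset) auto
  ultimately show ?thesis using le dimU by simp
qed

lemma antipart_in_stratum: "admissible K \<Longrightarrow> antipart K \<in> stratum (2 * rank K)"
  using antipart_odd rank_antipart by (auto simp: stratum_def admissible_def psd_transpose)

lemma odd_transpose: "S \<in> odd_mats \<Longrightarrow> transpose S = S"
  by (simp add: odd_mats_def)

text \<open>Conjugation by \<open>J\<close> turns \<open>S\<close> into \<open>- S\<close>, hence
  the positive part into the negative part.\<close>

lemma odd_neg_part:
  assumes "S \<in> odd_mats" shows "J ** pos_part S ** J = pos_part S - S"
  using pos_part_orthogonal[OF odd_transpose[OF assms] J_orthogonal] assms
    pos_part_uminus[OF odd_transpose[OF assms]]
  by (simp add: odd_mats_def J_sym)

lemma antipart_pos_part: "S \<in> odd_mats \<Longrightarrow> antipart (pos_part S) = S"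
  by (simp add: antipart_def odd_neg_part)

lemma pos_part_commute:
  assumes "S \<in> odd_mats" "g \<in> G" shows "g ** pos_part S = pos_part S ** g"
proof -
  have g: "orthogonal_matrix g" using G_orthogonal assms(2) .
  have "g ** S ** transpose g = S"
    by (rule orthogonal_commute_iff[OF g, THEN iffD2]) (use assms in \<open>simp add: odd_mats_def\<close>)
  then have "g ** pos_part S ** transpose g = pos_part S"
    using pos_part_orthogonal[OF odd_transpose[OF assms(1)] g] by simp
  then show ?thesis by (rule orthogonal_commute_iff[OF g, THEN iffD1])
qed

text \<open>This is complementarity of positive and negative part, with the latter written as the
  \<open>J\<close>-conjugate of the former.\<close>

lemma pos_part_isotropic:
  assumes "S \<in> odd_mats" shows "pos_part S ** J ** pos_part S = 0"
proof -
  have "J ** (J ** pos_part S ** J ** pos_part S) = 0"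
    using pos_part_mult[OF odd_transpose[OF assms]] odd_neg_part[OF assms] by simp
  then show ?thesis by (metis J_inv matrix_mul_assoc matrix_mul_lid)
qed

lemma isotropic_vector:
  assumes "K ** J ** K = 0" "transpose K = K"
  shows "(K *v x) \<bullet> (J *v (K *v y)) = 0"
proof -
  have "(K *v x) \<bullet> (J *v (K *v y)) = x \<bullet> ((K ** J ** K) *v y)"
    by (metis assms(2) inner_matrix_vector matrix_vector_mul_assoc)
  then show ?thesis by (simp add: assms(1))
qed

lemma isotropic_admissible:
  assumes K: "psd K" "\<And>g. g \<in> G \<Longrightarrow> g ** K = K ** g"
    and iso: "\<And>x. (K *v x) \<bullet> (J *v (K *v x)) = 0"
  shows "admissible K"
  unfolding admissible_def
proof (intro conjI allI impI ballI K)
  show "K *v x = 0" if "J *v (K *v x) = K *v x" for x using iso[of x] that by simp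
  show "K *v x = 0" if "J *v (K *v x) = - (K *v x)" for x using iso[of x] that by simp
qed

lemma pos_part_admissible:
  assumes "S \<in> odd_mats" shows "admissible (pos_part S)"
  using assms pos_part_commute psd_pos_part psd_transpose[OF psd_pos_part]
  by (intro isotropic_admissible isotropic_vector pos_part_isotropic) auto

lemma rank_pos_part: "S \<in> odd_mats \<Longrightarrow> rank S = 2 * rank (pos_part S)"
  using rank_antipart[OF pos_part_admissible] by (simp add: antipart_pos_part)

lemma range_proj_commute:
  assumes "is_range_proj P K" "orthogonal_matrix g" "g ** K = K ** g"
  shows "g ** P = P ** g"
proof -
  have "g ** K ** transpose g = K" by (rule orthogonal_commute_iff[OF assms(2), THEN iffD2]) fact
  then have "is_range_proj (g ** P ** transpose g) K"
    using range_proj_orthogonal_conj[OF assms(1,2)] by simp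
  then have "g ** P ** transpose g = P" using range_proj_unique assms(1) by blast
  then show ?thesis by (rule orthogonal_commute_iff[OF assms(2), THEN iffD1])
qed

text \<open>The differences of positive and of negative parts are conjugate under \<open>J\<close>,
  so the two squares in \<open>pos_part_norm_diff\<close> coincide.\<close>

lemma norm_pos_part_diff:
  assumes "S \<in> odd_mats" "T \<in> odd_mats"
  shows "2 * (norm (pos_part S - pos_part T))\<^sup>2 \<le> (norm (S - T))\<^sup>2"
proof -
  have "J ** (pos_part S - pos_part T) ** J = (pos_part S - S) - (pos_part T - T)"
    by (simp add: matrix_diff_ldistrib matrix_diff_rdistrib odd_neg_part assms)
  then have "norm ((pos_part S - S) - (pos_part T - T)) = norm (pos_part S - pos_part T)"
    using norm_J[of "pos_part S - pos_part T"] by simp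
  then show ?thesis using pos_part_norm_diff[of S T] assms odd_transpose by simp
qed

end

section \<open>The two-leg curve between matrices with nondegenerate ranges\<close>

context graded_symmetry
begin

text \<open>Each \<open>v\<close> in the range of \<open>K\<close> and its image
  \<open>P *v v\<close> are isotropic, though
  \<open>T *v v = (1 - t) *\<^sub>R (P *v v) + t *\<^sub>R v\<close> need not be;
  \<open>isotropic_combination_zero\<close> still keeps it from being a nonzero eigenvector of
  \<open>J\<close>.\<close>

lemma compression_admissible:
  assumes K: "psd K" "\<And>g. g \<in> G \<Longrightarrow> g ** K = K ** g" "K ** J ** K = 0"
    and L: "transpose L = L" "\<And>g. g \<in> G \<Longrightarrow> g ** L = L ** g" "L ** J ** L = 0"
    and P: "is_range_proj P L" and t: "0 < t" "t \<le> 1"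
  defines "T \<equiv> (1 - t) *\<^sub>R P + t *\<^sub>R mat 1"
  shows "admissible (T ** K ** T)" "rank (T ** K ** T) = rank K"
proof -
  have PT: "transpose P = P" "P ** P = P" using is_range_projD[OF P] by auto
  have TT: "transpose T = T" by (simp add: T_def matrix_arith PT)
  obtain M where M: "P = L ** M" using P by (auto simp: is_range_proj_def)
  have PJ: "(P *v x) \<bullet> (J *v (P *v x)) = 0" for x
    using isotropic_vector[OF L(3,1), of "M *v x" "M *v x"] by (simp add: M matrix_vector_mul_assoc)
  have com: "g ** T = T ** g" if "g \<in> G" for g
    using range_proj_commute[OF P G_orthogonal[OF that] L(2)[OF that]]
    by (simp add: T_def matrix_arith)
  have zero: "T *v (K *v y) = 0" if "J *v (T *v (K *v y)) = s *\<^sub>R (T *v (K *v y))" "s = 1 \<or> s = -1" for y s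
  proof -
    define v where "v = K *v y"
    have "v \<bullet> (P *v v) = (P *v v) \<bullet> (P *v v)"
      by (metis PT inner_matrix_vector inner_commute matrix_vector_mul_assoc)
    moreover have e: "T *v v = (1 - t) *\<^sub>R (P *v v) + t *\<^sub>R v"
      by (simp add: T_def matrix_vector_arith)
    moreover have "v \<bullet> (J *v v) = 0"
      unfolding v_def by (rule isotropic_vector[OF K(3) psd_transpose[OF K(1)]])
    ultimately have "v = 0"
      using isotropic_combination_zero[OF J_sym J_inv _ PJ, of v v t s "T *v v"] t that
      by (simp add: v_def)
    then show ?thesis by (simp add: v_def)
  qed
  show "admissible (T ** K ** T)"
    unfolding admissible_def
  proof (intro conjI allI impI ballI)
    show "psd (T ** K ** T)" using psd_congruence[OF K(1), of T] by (simp add: TT)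
    show "g ** (T ** K ** T) = T ** K ** T ** g" if "g \<in> G" for g
      using com[OF that] K(2)[OF that] by (metis matrix_mul_assoc)
    show "T ** K ** T *v x = 0" if "J *v (T ** K ** T *v x) = T ** K ** T *v x" for x
      using zero[of "T *v x" 1] that by (simp add: matrix_vector_mul_assoc matrix_mul_assoc)
    show "T ** K ** T *v x = 0" if "J *v (T ** K ** T *v x) = - (T ** K ** T *v x)" for x
      using zero[of "T *v x" "-1"] that by (simp add: matrix_vector_mul_assoc matrix_mul_assoc)
  qed
  \<comment> \<open>The inverse of \<open>T\<close>, which acts as 1 on the range of
    \<open>P\<close> and as \<open>t\<close> on its complement.\<close>
  define U where "U = P + (1 / t) *\<^sub>R (mat 1 - P)"
  have "T ** U = mat 1" "U ** T = mat 1"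
    using t by (simp_all add: T_def U_def matrix_arith PT algebra_simps)
  then have "K = U ** (T ** K ** T) ** U" by (metis matrix_mul_assoc matrix_mul_lid matrix_mul_rid)
  then have "rank K \<le> rank (T ** K ** T)"
    by (metis rank_mul_le_left rank_mul_le_right le_trans)
  moreover have "rank (T ** K ** T) \<le> rank K"
    by (meson rank_mul_le_left rank_mul_le_right le_trans)
  ultimately show "rank (T ** K ** T) = rank K" by simp
qed

text \<open>The range of \<open>M\<close> lies in that of \<open>P\<close> and so is isotropic.
  Kernels of sums of positive semidefinite matrices are intersections, whence \<open>M\<close> has
  the kernel of \<open>P\<close>.\<close>

lemma segment_admissible:
  assumes K: "psd K" "\<And>g. g \<in> G \<Longrightarrow> g ** K = K ** g"
    and L: "psd L" "\<And>g. g \<in> G \<Longrightarrow> g ** L = L ** g" "L ** J ** L = 0"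
    and P: "is_range_proj P L" and nd: "\<And>x. K *v (P *v x) = 0 \<Longrightarrow> P *v x = 0"
    and s: "0 \<le> s" "s \<le> 1"
  defines "M \<equiv> (1 - s) *\<^sub>R L + s *\<^sub>R (P ** K ** P)"
  shows "admissible M" "rank M = rank L"
proof -
  have PT: "transpose P = P" "P ** P = P" "P ** L = L" using is_range_projD[OF P] by auto
  obtain N where N: "P = L ** N" using P by (auto simp: is_range_proj_def)
  have PJ: "(P *v x) \<bullet> (J *v (P *v x)) = 0" for x
    using isotropic_vector[OF L(3) psd_transpose[OF L(1)], of "N *v x" "N *v x"] by (simp add: N matrix_vector_mul_assoc)
  have pPK: "psd (P ** K ** P)" using psd_congruence[OF K(1), of P] by (simp add: PT)
  have pM: "psd M" unfolding M_def using s pPK L by (intro psd_add psd_scaleR) auto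
  have PM: "P ** M = M" by (simp add: M_def matrix_arith PT)
  show "admissible M"
  proof (rule isotropic_admissible[OF pM])
    show "g ** M = M ** g" if "g \<in> G" for g
    proof -
      have "g ** P = P ** g"
        using range_proj_commute[OF P G_orthogonal[OF that] L(2)[OF that]] .
      then have "g ** (P ** K ** P) = P ** K ** P ** g"
        using K(2)[OF that] by (metis matrix_mul_assoc)
      then show ?thesis using L(2)[OF that]
        by (simp add: M_def matrix_add_ldistrib matrix_add_rdistrib matrix_scaleR_left matrix_scaleR_right)
    qed
    show "(M *v x) \<bullet> (J *v (M *v x)) = 0" for x
      using PJ[of "M *v x"] PM by (simp add: matrix_vector_mul_assoc matrix_mul_assoc)
  qed
  have PKnull: "P *v x = 0" if "(P ** K ** P) *v x = 0" for x
  proof -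
    have "(P *v x) \<bullet> (K *v (P *v x)) = x \<bullet> ((P ** K ** P) *v x)"
      by (metis PT(1) inner_matrix_vector matrix_vector_mul_assoc)
    then show ?thesis using that nd psd_null[OF K(1)] by simp
  qed
  have "M *v x = 0 \<longleftrightarrow> P *v x = 0" for x
  proof
    assume z: "M *v x = 0"
    have "((1 - s) *\<^sub>R L) *v x = 0 \<and> (s *\<^sub>R (P ** K ** P)) *v x = 0"
      by (rule psd_add_null) (use s pPK L z in \<open>auto simp: M_def intro: psd_scaleR\<close>)
    \<comment> \<open>At \<open>s = 0\<close> only the summand \<open>L\<close> controls the kernel;
      for \<open>s > 0\<close> the compression of \<open>K\<close> does, by nondegeneracy.\<close>
    then show "P *v x = 0"
      using PKnull[of x] range_proj_null[OF P psd_transpose[OF L(1)], of x]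
      by (cases "s = 0") (auto simp: matrix_vector_scaleR_left)
  next
    assume "P *v x = 0"
    moreover have "M ** P = M"
      by (metis PM PT(1) matrix_transpose_mul pM psd_transpose)
    ultimately show "M *v x = 0" by (metis matrix_vector_mul_assoc matrix_vector_mult_0_right)
  qed
  then have "rank M = rank P" using PT(1) pM psd_transpose by (intro rank_cong_null) auto
  then show "rank M = rank L" using range_proj_rank[OF P] by simp
qed

text \<open>The curve is built from the \<open>A\<close> side: a segment to the compression
  \<open>X\<close> of \<open>K\<close>, then the reversed shrinking from \<open>X\<close> up to
  \<open>K\<close>.\<close>

lemma joined_within_nondegenerate:
  assumes A: "A \<in> stratum k" and B: "B \<in> stratum k"
    and P: "is_range_proj P (pos_part A)"
    and nd: "\<And>x. pos_part B *v (P *v x) = 0 \<Longrightarrow> P *v x = 0"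
  shows "joined_within (stratum k) A B (sqrt 6 * dist A B)"
proof -
  define K L where "K = pos_part B" and "L = pos_part A"
  have odd: "A \<in> odd_mats" "B \<in> odd_mats" and rk: "2 * rank K = k" "2 * rank L = k"
    using A B rank_pos_part by (auto simp: stratum_def K_def L_def)
  have K: "psd K" "\<And>g. g \<in> G \<Longrightarrow> g ** K = K ** g" "K ** J ** K = 0"
    using pos_part_commute[OF odd(2)] pos_part_isotropic[OF odd(2)] by (auto simp: K_def psd_pos_part)
  have L: "psd L" "\<And>g. g \<in> G \<Longrightarrow> g ** L = L ** g" "L ** J ** L = 0"
    using pos_part_commute[OF odd(1)] pos_part_isotropic[OF odd(1)] by (auto simp: L_def psd_pos_part)
  have P: "is_range_proj P L" using P by (simp add: L_def)
  have PT: "transpose P = P" "P ** P = P" "P ** L = L" using is_range_projD[OF P] by auto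
  have LP: "L ** P = L" using range_proj_mult_right[OF P psd_transpose[OF L(1)]] .
  define R where "R = mat 1 - P"
  have R: "transpose R = R" "P ** R = 0" "R ** P = 0" by (simp_all add: R_def matrix_arith PT)
  \<comment> \<open>The blocks of \<open>K\<close> relative to \<open>P\<close>: under the shrinking
    with parameter \<open>t\<close> they scale with degree 0, 1 and 2, which explains the quadratic
    control function of the second leg.\<close>
  define X Y Z where "X = P ** K ** P" and "Y = P ** K ** R + R ** K ** P" and "Z = R ** K ** R"
  have KXYZ: "K = X + Y + Z"
    by (simp add: X_def Y_def Z_def R_def matrix_arith)
  have comp: "((1 - t) *\<^sub>R P + t *\<^sub>R mat 1) ** K ** ((1 - t) *\<^sub>R P + t *\<^sub>R mat 1)
      = X + t *\<^sub>R Y + t\<^sup>2 *\<^sub>R Z" (is "?T ** K ** ?T = _") for t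
  proof -
    have "?T = P + t *\<^sub>R R" by (simp add: R_def algebra_simps)
    then show ?thesis
      by (simp add: X_def Y_def Z_def matrix_arith power2_eq_square algebra_simps)
  qed
  define p q w where "p = norm (X - L)" and "q = norm Y" and "w = norm Z"
  have orth1: "(P ** M) \<bullet> (R ** N) = 0" for M N :: "real ^ 'h ^ 'h"
    by (simp add: inner_matrix_mult_left[of P] PT matrix_mul_assoc R)
  have orth2: "(M ** P) \<bullet> (N ** R) = 0" for M N :: "real ^ 'h ^ 'h"
  proof -
    have "(M ** P) \<bullet> (N ** R) = M \<bullet> (N ** (R ** P))"
      by (simp add: inner_matrix_mult_right[of M] PT matrix_mul_assoc)
    then show ?thesis by (simp add: R)
  qed
  have XL: "X - L = P ** (K ** P - L)" "X - L = (P ** K - L) ** P"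
    by (simp_all add: X_def matrix_arith PT LP)
  have o: "(X - L) \<bullet> Y = 0" "(X - L) \<bullet> Z = 0" "Y \<bullet> Z = 0"
  proof -
    have "(X - L) \<bullet> (P ** K ** R) = 0" unfolding XL(2) by (rule orth2)
    moreover have "(X - L) \<bullet> (R ** K ** P) = 0"
      unfolding XL(1) matrix_mul_assoc[of R, symmetric] by (rule orth1)
    ultimately show "(X - L) \<bullet> Y = 0" by (simp add: Y_def inner_add_right)
    show "(X - L) \<bullet> Z = 0" unfolding XL(2) Z_def by (rule orth2)
    have "(P ** K ** R) \<bullet> Z = 0"
      unfolding Z_def matrix_mul_assoc[symmetric] by (rule orth1)
    moreover have "(R ** K ** P) \<bullet> Z = 0" unfolding Z_def by (rule orth2)
    ultimately show "Y \<bullet> Z = 0" by (simp add: Y_def inner_add_left)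
  qed
  define D where "D = X - L"
  have "K - L = D + Y + Z" by (simp add: KXYZ D_def)
  then have "(norm (K - L))\<^sup>2 = p\<^sup>2 + q\<^sup>2 + w\<^sup>2"
    using o by (simp add: power2_norm_eq_inner p_def q_def w_def inner_add_left inner_add_right
        inner_commute flip: D_def)
  moreover have "2 * (norm (K - L))\<^sup>2 \<le> (dist A B)\<^sup>2"
    using norm_pos_part_diff[OF odd(2,1)] by (simp add: K_def L_def dist_norm norm_minus_commute)
  ultimately have "2 * (p\<^sup>2 + q\<^sup>2 + w\<^sup>2) \<le> (dist A B)\<^sup>2" by simp
  \<comment> \<open>Here the sum of the three lengths is traded for the root of the sum of squares,
    at the price of sqrt 3.\<close>
  moreover have "(p + q + w)\<^sup>2 \<le> 3 * (p\<^sup>2 + q\<^sup>2 + w\<^sup>2)"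
    using zero_le_power2[of "p - q"] zero_le_power2[of "p - w"] zero_le_power2[of "q - w"]
    by (simp add: power2_eq_square algebra_simps)
  ultimately have "2 * (p + q + w)\<^sup>2 \<le> 3 * (dist A B)\<^sup>2" by (simp add: algebra_simps)
  then have "(2 * (p + q + w))\<^sup>2 \<le> (sqrt 6 * dist A B)\<^sup>2"
    by (simp add: power_mult_distrib del: distrib_left_numeral)
  then have total: "2 * p + 2 * (q + w) \<le> sqrt 6 * dist A B"
    by (intro power2_le_imp_le[where x = "2 * p + 2 * (q + w)"]) (simp_all add: algebra_simps)
  have mem: "antipart M \<in> stratum k" if "admissible M" "2 * rank M = k" for M
    using antipart_in_stratum[OF that(1)] that(2) by simp
  have leg1: "joined_within (stratum k) A (antipart X) (2 * p)"
  proof (rule joined_withinI[where g = "\<lambda>s. (1 - s) *\<^sub>R A + s *\<^sub>R antipart X" and h = "\<lambda>s. 2 * p * s"])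
    have A': "A = antipart L" by (simp add: L_def antipart_pos_part odd)
    show "path_image (\<lambda>s. (1 - s) *\<^sub>R A + s *\<^sub>R antipart X) \<subseteq> stratum k"
    proof (clarsimp simp: path_image_def)
      fix s :: real assume s: "0 \<le> s" "s \<le> 1"
      have "antipart ((1 - s) *\<^sub>R L + s *\<^sub>R X) \<in> stratum k"
        unfolding X_def using segment_admissible[OF K(1,2) L P _ s] nd rk by (intro mem) (auto simp: K_def)
      then show "(1 - s) *\<^sub>R A + s *\<^sub>R antipart X \<in> stratum k"
        by (simp add: A' antipart_arith)
    qed
    fix s t :: real assume st: "0 \<le> s" "s \<le> t" "t \<le> 1"
    have "((1 - s) *\<^sub>R A + s *\<^sub>R antipart X) - ((1 - t) *\<^sub>R A + t *\<^sub>R antipart X)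
        = (s - t) *\<^sub>R antipart (X - L)"
      by (simp add: A' antipart_arith algebra_simps)
    then have "dist ((1 - s) *\<^sub>R A + s *\<^sub>R antipart X) ((1 - t) *\<^sub>R A + t *\<^sub>R antipart X)
        = (t - s) * norm (antipart (X - L))"
      using st by (simp add: dist_norm)
    also have "\<dots> \<le> (t - s) * (2 * p)"
      unfolding p_def using st by (intro mult_left_mono norm_antipart_le) auto
    finally show "dist ((1 - s) *\<^sub>R A + s *\<^sub>R antipart X) ((1 - t) *\<^sub>R A + t *\<^sub>R antipart X)
        \<le> 2 * p * t - 2 * p * s" by (simp add: algebra_simps)
  qed (auto simp: path_def pathstart_def pathfinish_def intro!: continuous_intros)
  have leg2: "joined_within (stratum k) (antipart X) B (2 * (q + w))"
  proof (rule joined_withinI[where g = "\<lambda>t. antipart X + t *\<^sub>R antipart Y + t\<^sup>2 *\<^sub>R antipart Z"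
        and h = "\<lambda>t. 2 * q * t + 2 * w * t\<^sup>2"])
    show "path_image (\<lambda>t. antipart X + t *\<^sub>R antipart Y + t\<^sup>2 *\<^sub>R antipart Z) \<subseteq> stratum k"
    proof (clarsimp simp: path_image_def)
      fix t :: real assume t: "0 \<le> t" "t \<le> 1"
      have "antipart (X + t *\<^sub>R Y + t\<^sup>2 *\<^sub>R Z) \<in> stratum k"
      \<comment> \<open>At \<open>t = 0\<close> the matrix \<open>T\<close> is the projection
        \<open>P\<close> and may fail to be invertible; this point is the end of the first
        leg.\<close>
      proof (cases "t = 0")
        case True
        have "rank X = rank L" "admissible X"
          using segment_admissible[OF K(1,2) L P, of 1] nd by (auto simp: X_def K_def)
        then show ?thesis using rk by (intro mem) (auto simp: True)
      next
        case False
        then show ?thesis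
          using compression_admissible[OF K psd_transpose[OF L(1)] L(2,3) P, of t] t rk
          unfolding comp by (intro mem) auto
      qed
      then show "antipart X + t *\<^sub>R antipart Y + t\<^sup>2 *\<^sub>R antipart Z \<in> stratum k"
        by (simp add: antipart_arith)
    qed
    show "pathfinish (\<lambda>t. antipart X + t *\<^sub>R antipart Y + t\<^sup>2 *\<^sub>R antipart Z) = B"
      using antipart_pos_part[OF odd(2)] by (simp add: pathfinish_def flip: antipart_arith KXYZ K_def)
    fix s t :: real assume st: "0 \<le> s" "s \<le> t" "t \<le> 1"
    have "norm ((antipart X + t *\<^sub>R antipart Y + t\<^sup>2 *\<^sub>R antipart Z) - (antipart X + s *\<^sub>R antipart Y + s\<^sup>2 *\<^sub>R antipart Z))
        = norm ((t - s) *\<^sub>R antipart Y + (t\<^sup>2 - s\<^sup>2) *\<^sub>R antipart Z)"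
      by (simp add: algebra_simps)
    also have "\<dots> \<le> (t - s) * norm (antipart Y) + (t\<^sup>2 - s\<^sup>2) * norm (antipart Z)"
      using st by (intro norm_triangle_le) (simp add: power_mono)
    also have "\<dots> \<le> (t - s) * (2 * q) + (t\<^sup>2 - s\<^sup>2) * (2 * w)"
      unfolding q_def w_def using st by (intro add_mono mult_left_mono norm_antipart_le) (auto simp: power_mono)
    finally show "dist (antipart X + s *\<^sub>R antipart Y + s\<^sup>2 *\<^sub>R antipart Z) (antipart X + t *\<^sub>R antipart Y + t\<^sup>2 *\<^sub>R antipart Z)
        \<le> 2 * q * t + 2 * w * t\<^sup>2 - (2 * q * s + 2 * w * s\<^sup>2)"
      unfolding dist_norm by (subst norm_minus_commute) (simp add: algebra_simps)
  qed (auto simp: path_def pathstart_def intro!: continuous_intros)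
  show ?thesis
    using joined_within_mono[OF joined_within_trans[OF leg1 leg2] total] .
qed

end

section \<open>Block matrices, polar decomposition and the Cayley transform\<close>

definition vjoin :: "'a ^ 'm \<Rightarrow> 'a ^ 'n \<Rightarrow> 'a ^ ('m + 'n)"
  where "vjoin x y = (\<chi> i. case i of Inl i \<Rightarrow> x $ i | Inr i \<Rightarrow> y $ i)"

definition blk :: "'a ^ 'c ^ 'm \<Rightarrow> 'a ^ 'd ^ 'm \<Rightarrow> 'a ^ 'c ^ 'n \<Rightarrow> 'a ^ 'd ^ 'n \<Rightarrow> 'a ^ ('c + 'd) ^ ('m + 'n)"
  where "blk A B C D = (\<chi> i. case i of Inl i \<Rightarrow> vjoin (A $ i) (B $ i) | Inr i \<Rightarrow> vjoin (C $ i) (D $ i))"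

lemma all_sum_iff: "(\<forall>i. P i) \<longleftrightarrow> (\<forall>i. P (Inl i)) \<and> (\<forall>i. P (Inr i))"
  by (metis sum.exhaust)

lemma sum_UNIV_sum:
  fixes f :: "'m::finite + 'n::finite \<Rightarrow> 'a::comm_monoid_add"
  shows "(\<Sum>i\<in>UNIV. f i) = (\<Sum>i\<in>UNIV. f (Inl i)) + (\<Sum>i\<in>UNIV. f (Inr i))"
  by (subst UNIV_Plus_UNIV[symmetric], subst sum.Plus) auto

lemma vjoin_nth [simp]: "vjoin x y $ Inl i = x $ i" "vjoin x y $ Inr j = y $ j"
  by (simp_all add: vjoin_def)

lemma blk_nth [simp]:
  "blk A B C D $ Inl i = vjoin (A $ i) (B $ i)" "blk A B C D $ Inr j = vjoin (C $ j) (D $ j)"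
  by (simp_all add: blk_def)

lemma vjoin_eq_iff [simp]: "vjoin x y = vjoin x' y' \<longleftrightarrow> x = x' \<and> y = y'"
  by (auto simp: vec_eq_iff all_sum_iff)

lemma blk_eq_iff [simp]:
  "blk A B C D = blk A' B' C' D' \<longleftrightarrow> A = A' \<and> B = B' \<and> C = C' \<and> D = D'"
  by (auto simp: vec_eq_iff[of "blk _ _ _ _"] all_sum_iff) (simp_all add: vec_eq_iff)

lemma vjoin_cases: obtains x y where "v = vjoin x y"
proof
  show "v = vjoin (\<chi> i. v $ Inl i) (\<chi> i. v $ Inr i)" by (simp add: vec_eq_iff all_sum_iff)
qed

lemma blk_cases: obtains A B C D where "M = blk A B C D"
proof
  show "M = blk (\<chi> i j. M $ Inl i $ Inl j) (\<chi> i j. M $ Inl i $ Inr j)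
     (\<chi> i j. M $ Inr i $ Inl j) (\<chi> i j. M $ Inr i $ Inr j)"
    by (simp add: vec_eq_iff all_sum_iff)
qed

lemma vjoin_arith:
  "vjoin x y + vjoin x' y' = vjoin (x + x') (y + y')"
  "vjoin x y - vjoin x' y' = vjoin (x - x') (y - y')"
  "- vjoin x y = vjoin (- x) (- y)"
  "vjoin 0 0 = (0 :: 'a::ab_group_add ^ _)"
  for x :: "'a::ab_group_add ^ 'm" and y :: "'a ^ 'n"
  by (simp_all add: vec_eq_iff all_sum_iff)

lemma blk_arith:
  "blk A B C D + blk A' B' C' D' = blk (A + A') (B + B') (C + C') (D + D')"
  "blk A B C D - blk A' B' C' D' = blk (A - A') (B - B') (C - C') (D - D')"
  "- blk A B C D = blk (- A) (- B) (- C) (- D)"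
  "blk 0 0 0 0 = (0 :: 'a::ab_group_add ^ ('c + 'd) ^ ('m + 'n))"
  for A :: "'a::ab_group_add ^ 'c ^ 'm" and B :: "'a ^ 'd ^ 'm" and C :: "'a ^ 'c ^ 'n" and D :: "'a ^ 'd ^ 'n"
  by (simp_all add: vec_eq_iff all_sum_iff)

lemma blk_mat_one: "mat 1 = blk (mat 1) 0 0 (mat 1)"
  by (simp add: vec_eq_iff all_sum_iff mat_def)

lemma transpose_blk: "transpose (blk A B C D) = blk (transpose A) (transpose C) (transpose B) (transpose D)"
  by (simp add: vec_eq_iff all_sum_iff transpose_def)

lemma blk_mult:
  "blk A B C D ** blk A' B' C' D' =
    blk (A ** A' + B ** C') (A ** B' + B ** D') (C ** A' + D ** C') (C ** B' + D ** D')"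
  by (simp add: vec_eq_iff all_sum_iff matrix_matrix_mult_def sum_UNIV_sum)

lemma blk_mult_vector: "blk A B C D *v vjoin x y = vjoin (A *v x + B *v y) (C *v x + D *v y)"
  by (simp add: vec_eq_iff all_sum_iff matrix_vector_mult_def sum_UNIV_sum)

lemma inner_vjoin: "vjoin x y \<bullet> vjoin x' y' = x \<bullet> x' + y \<bullet> (y' :: 'a::real_inner ^ 'n)"
  by (simp add: inner_vec_def sum_UNIV_sum)

lemma inner_blk:
  "blk A B C D \<bullet> blk A' B' C' D' = A \<bullet> A' + B \<bullet> B' + C \<bullet> C' + D \<bullet> (D' :: 'a::real_inner ^ 'd ^ 'n)"
  by (simp add: inner_vec_def[of "blk _ _ _ _"] sum_UNIV_sum inner_vjoin)
     (simp add: inner_vec_def sum.distrib)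

definition dilation :: "real ^ 'n ^ 'm \<Rightarrow> real ^ ('m + 'n) ^ ('m + 'n)"
  where "dilation A = blk 0 A (transpose A) 0"

definition grading :: "real ^ ('m::finite + 'n::finite) ^ ('m + 'n)"
  where "grading = blk (mat 1) 0 0 (- mat 1)"

lemma graded_symmetry_grading:
  assumes "\<And>g. g \<in> G \<Longrightarrow> orthogonal_matrix g"
    and "\<And>g. g \<in> G \<Longrightarrow> g ** grading = grading ** g \<or> g ** grading = - (grading ** g)"
  shows "graded_symmetry grading G"
  using assms by unfold_locales
    (auto simp: grading_def blk_mult transpose_blk transpose_minus matrix_arith blk_mat_one)

lemma odd_grading_iff:
  fixes S :: "real ^ ('m::finite + 'n::finite) ^ ('m + 'n)"
  shows "transpose S = S \<and> grading ** S ** grading = - S \<longleftrightarrow> (\<exists>A. S = dilation A)"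
proof -
  obtain A B C D where S: "S = blk A B C D" by (rule blk_cases)
  have "A = - A \<longleftrightarrow> A = 0" "D = - D \<longleftrightarrow> D = 0"
    by (simp_all add: vec_eq_iff)
  then show ?thesis
    by (auto simp: S transpose_blk grading_def blk_mult matrix_arith blk_arith dilation_def)
qed

section \<open>Polar decomposition and Cayley transform\<close>

text \<open>For the blocks of the positive part of \<open>dilation M\<close>, isotropy says
  \<open>A ** A = B ** C\<close> and the antipart says \<open>M = 2 *\<^sub>R B\<close>. The
  equivariance of the positive part then passes to the factor \<open>Q\<close>.\<close>

lemma polar_decomposition:
  fixes M :: "real ^ 'n ^ 'n"
  assumes M: "invertible M"
  obtains P Q where "psd P" "orthogonal_matrix Q" "M = P ** Q"
    "\<And>g h. orthogonal_matrix g \<Longrightarrow> orthogonal_matrix h \<Longrightarrow> g ** M = M ** h \<Longrightarrow> g ** Q = Q ** h"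
proof -
  interpret graded_symmetry "grading :: real ^ ('n + 'n) ^ ('n + 'n)" "{}"
    by (rule graded_symmetry_grading) auto
  have odd: "dilation M \<in> odd_mats"
    using odd_grading_iff[of "dilation M"] by (auto simp: odd_mats_def)
  define K where "K = pos_part (dilation M)"
  have K: "psd K" by (simp add: K_def psd_pos_part)
  obtain A B C D where KB: "K = blk A B C D" by (rule blk_cases)
  have t: "transpose A = A" "transpose B = C"
    using psd_transpose[OF K] by (auto simp: KB transpose_blk)
  have "K ** grading ** K = 0" unfolding K_def by (rule pos_part_isotropic[OF odd])
  then have AA: "A ** A = B ** C"
    by (simp add: KB grading_def blk_mult matrix_arith flip: blk_arith(4))
  have "antipart K = dilation M" unfolding K_def by (rule antipart_pos_part[OF odd])
  then have MB: "M = 2 *\<^sub>R B"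
    unfolding antipart_def by (simp add: scaleR_2 KB grading_def blk_mult matrix_arith blk_arith dilation_def)
  \<comment> \<open>The positive semidefinite square root of
    \<open>M ** transpose M\<close>.\<close>
  define P where "P = 2 *\<^sub>R A"
  have pP: "psd P"
    unfolding psd_def
  proof (intro conjI allI)
    show "transpose P = P" by (simp add: P_def transpose_scalar t)
    show "0 \<le> x \<bullet> (P *v x)" for x
      using psd_nonneg[OF K, of "vjoin x 0"]
      by (simp add: P_def KB blk_mult_vector inner_vjoin matrix_vector_scaleR_left)
  qed
  have PP: "P ** P = M ** transpose M"
    using AA t by (simp add: P_def MB matrix_arith)
  have Pcom: "g ** P = P ** g" if g: "orthogonal_matrix g" and h: "orthogonal_matrix h" and gh: "g ** M = M ** h" for g h
  proof -
    \<comment> \<open>The relation \<open>g ** M = M ** h\<close> says that this block-diagonal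
      rotation fixes \<open>dilation M\<close>.\<close>
    define k where "k = blk g 0 0 h"
    have k: "orthogonal_matrix k"
      using g h by (simp add: k_def orthogonal_matrix_def transpose_blk blk_mult blk_mat_one)
    have "transpose M ** transpose g = transpose h ** transpose M"
      using gh by (metis matrix_transpose_mul)
    then have "h ** transpose M ** transpose g = h ** transpose h ** transpose M"
      by (metis matrix_mul_assoc)
    then have "h ** transpose M ** transpose g = transpose M"
      using h by (simp add: orthogonal_matrix_def)
    moreover have "g ** M ** transpose h = M"
      using gh h unfolding orthogonal_matrix_def by (metis matrix_mul_assoc matrix_mul_rid)
    ultimately have "k ** dilation M ** transpose k = dilation M"
      by (simp add: k_def dilation_def transpose_blk blk_mult)
    then have "k ** K ** transpose k = K"
      using pos_part_orthogonal[OF odd_transpose[OF odd] k] by (simp add: K_def)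
    then have "g ** A ** transpose g = A"
      by (simp add: k_def KB transpose_blk blk_mult)
    then have "g ** A = A ** g"
      by (rule orthogonal_commute_iff[OF g, THEN iffD1])
    then show ?thesis by (simp add: P_def matrix_arith)
  qed
  have "invertible (M ** transpose M)"
    using M by (intro invertible_mult) (auto simp: transpose_invertible)
  then obtain N where N: "P ** P ** N = mat 1" "N ** (P ** P) = mat 1"
    unfolding PP[symmetric] invertible_def by auto
  define R where "R = P ** N"
  have PR: "P ** R = mat 1" using N by (simp add: R_def matrix_mul_assoc)
  then have RP: "R ** P = mat 1" by (simp add: matrix_left_right_inverse)
  have tR: "transpose R = R"
    by (metis PR RP matrix_mul_assoc matrix_mul_lid matrix_mul_rid matrix_transpose_mul pP psd_transpose transpose_mat)
  show ?thesis
  proof (rule that[of P "R ** M"])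
    show "psd P" by (rule pP)
    have "(R ** M) ** transpose (R ** M) = R ** (M ** transpose M) ** R"
      by (simp add: matrix_transpose_mul matrix_mul_assoc tR)
    also have "\<dots> = (R ** P) ** (P ** R)" by (simp add: PP[symmetric] matrix_mul_assoc)
    finally have "(R ** M) ** transpose (R ** M) = mat 1" by (simp add: PR RP)
    then show "orthogonal_matrix (R ** M)"
      by (simp add: orthogonal_matrix_def matrix_left_right_inverse)
    show "M = P ** (R ** M)" by (simp add: matrix_mul_assoc PR)
    fix g h assume gh: "orthogonal_matrix g" "orthogonal_matrix h" "g ** M = M ** h"
    have "g ** R = R ** g"
      using Pcom[OF gh] by (metis PR RP matrix_mul_assoc matrix_mul_lid matrix_mul_rid)
    then show "g ** (R ** M) = R ** M ** h"
      using gh(3) by (metis matrix_mul_assoc)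
  qed
qed

lemma invertible_of_kernel:
  fixes M :: "real ^ 'n ^ 'n"
  assumes "\<And>x. M *v x = 0 \<Longrightarrow> x = 0"
  obtains N where "M ** N = mat 1" "N ** M = mat 1"
  using assms matrix_left_invertible_ker[of M] matrix_left_right_inverse by metis

lemma norm_orthogonal_matrix:
  fixes Q :: "real ^ 'n ^ 'n"
  assumes "orthogonal_matrix Q" shows "norm Q = norm (mat 1 :: real ^ 'n ^ 'n)"
proof -
  have "Q \<bullet> Q = (Q ** mat 1) \<bullet> Q" by simp
  also have "\<dots> = mat 1 \<bullet> (mat 1 :: real ^ 'n ^ 'n)"
    using assms by (simp only: inner_matrix_mult_left orthogonal_matrix_def)
  finally show ?thesis by (simp add: norm_eq_sqrt_inner)
qed

lemma skew_pencil_kernel: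
  fixes Z :: "real ^ 'n ^ 'n"
  assumes Z: "transpose Z = - Z" and x: "(mat 1 + t *\<^sub>R Z) *v x = 0"
  shows "x = 0"
proof -
  have "x \<bullet> (Z *v x) = - (x \<bullet> (Z *v x))"
    by (metis Z inner_commute inner_matrix_vector inner_minus_left matrix_vector_minus_left)
  then have "x \<bullet> (Z *v x) = 0" by simp
  moreover have "x = - (t *\<^sub>R (Z *v x))"
    using x by (simp add: matrix_vector_arith add_eq_0_iff2)
  ultimately have "x \<bullet> x = 0"
    by (metis inner_minus_right inner_scaleR_right mult_zero_right neg_equal_zero)
  then show ?thesis by simp
qed

text \<open>The rotations \<open>q t\<close> are the Cayley transforms of \<open>t *\<^sub>R Z\<close>, where \<open>Z\<close> is the inverse Cayley
  transform of \<open>Q\<close>; the curve runs from the identity at \<open>0\<close> to \<open>Q\<close> at \<open>1\<close>.\<close>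

lemma cayley_curve:
  fixes Q :: "real ^ 'n ^ 'n"
  assumes Q: "orthogonal_matrix Q" and Q1: "\<And>x. Q *v x = - x \<Longrightarrow> x = 0"
  obtains Z q C where "transpose Z = - Z" "\<And>t. orthogonal_matrix (q t)"
    "\<And>t. q t ** (mat 1 - t *\<^sub>R Z) = mat 1 + t *\<^sub>R Z" "\<And>t. norm (q t - Q) \<le> C * \<bar>t - 1\<bar>"
    "\<And>g t. g ** Q = Q ** g \<Longrightarrow> g ** q t = q t ** g"
proof -
  have QQ: "transpose Q ** Q = mat 1" "Q ** transpose Q = mat 1"
    using Q by (auto simp: orthogonal_matrix_def)
  have "x = 0" if "(Q + mat 1) *v x = 0" for x
    using Q1[of x] that by (simp add: matrix_vector_arith add_eq_0_iff2)
  then obtain W where W: "(Q + mat 1) ** W = mat 1" "W ** (Q + mat 1) = mat 1"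
    using invertible_of_kernel by metis
  have Wcom: "g ** W = W ** g" if "g ** Q = Q ** g" for g
  proof -
    have "g ** (Q + mat 1) = (Q + mat 1) ** g" using that by (simp add: matrix_arith)
    then show ?thesis by (metis W matrix_mul_assoc matrix_mul_lid matrix_mul_rid)
  qed
  define Z where "Z = (Q - mat 1) ** W"
  have tW: "transpose W ** transpose Q = W"
  proof -
    have "transpose W ** transpose (Q + mat 1) = mat 1"
      by (metis W(1) matrix_transpose_mul transpose_mat)
    \<comment> \<open>Orthogonality factors the transpose of \<open>Q + mat 1\<close> through
      itself, which makes the transposed inverse computable.\<close>
    moreover have "transpose (Q + mat 1) = transpose Q ** (Q + mat 1)"
      by (simp add: matrix_arith QQ add.commute)
    ultimately have "transpose W ** transpose Q ** ((Q + mat 1) ** W) = W"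
      by (simp add: matrix_mul_assoc)
    then show ?thesis by (simp add: W)
  qed
  have tZ: "transpose Z = - Z"
  proof -
    have "transpose Z = transpose W ** transpose Q ** (mat 1 - Q)"
      by (simp add: Z_def matrix_arith QQ flip: matrix_mul_assoc[of "transpose W" "transpose Q" Q])
    also have "\<dots> = - Z" using Wcom[of Q] by (simp add: tW Z_def matrix_arith)
    finally show ?thesis .
  qed
  have inv: "x = 0" if "(mat 1 - t *\<^sub>R Z) *v x = 0" for x t
    using skew_pencil_kernel[OF tZ, of "- t"] that by simp
  have "\<exists>N. (mat 1 - t *\<^sub>R Z) ** N = mat 1 \<and> N ** (mat 1 - t *\<^sub>R Z) = mat 1" for t
    using invertible_of_kernel[of "mat 1 - t *\<^sub>R Z"] inv by metis
  then obtain N where N: "\<And>t. (mat 1 - t *\<^sub>R Z) ** N t = mat 1" "\<And>t. N t ** (mat 1 - t *\<^sub>R Z) = mat 1"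
    by metis
  define q where "q t = (mat 1 + t *\<^sub>R Z) ** N t" for t
  have q: "q t ** (mat 1 - t *\<^sub>R Z) = mat 1 + t *\<^sub>R Z" for t
    by (simp add: q_def N flip: matrix_mul_assoc)
  have oq: "orthogonal_matrix (q t)" for t
  proof -
    let ?A = "mat 1 - t *\<^sub>R Z" and ?B = "mat 1 + t *\<^sub>R Z"
    have tA: "transpose ?A = ?B" "transpose ?B = ?A" by (simp_all add: matrix_arith tZ)
    have "transpose (N t) ** ?B = mat 1"
      by (metis N(1) matrix_transpose_mul tA(1) transpose_mat)
    have "transpose (q t) ** q t = transpose (N t) ** (?A ** ?B) ** N t"
      by (simp add: q_def matrix_transpose_mul tA(2) matrix_mul_assoc)
    also have "?A ** ?B = ?B ** ?A"
      by (simp add: matrix_arith scaleR_right_distrib scaleR_right_diff_distrib)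
    also have "transpose (N t) ** (?B ** ?A) ** N t = (transpose (N t) ** ?B) ** (?A ** N t)"
      by (simp only: matrix_mul_assoc)
    also have "\<dots> = mat 1" using N(1) \<open>transpose (N t) ** ?B = mat 1\<close> by simp
    finally show ?thesis by (simp add: orthogonal_matrix_def matrix_left_right_inverse)
  qed
  have Q1': "Q ** (mat 1 - Z) = mat 1 + Z"
  proof -
    have "mat 1 - Z = (Q + mat 1) ** W - (Q - mat 1) ** W" by (simp add: W Z_def)
    also have "\<dots> = 2 *\<^sub>R W" by (simp add: matrix_arith scaleR_2)
    finally have "mat 1 - Z = 2 *\<^sub>R W" .
    moreover have "mat 1 + Z = (Q + mat 1) ** W + (Q - mat 1) ** W" by (simp add: W Z_def)
    then have "mat 1 + Z = 2 *\<^sub>R (Q ** W)" by (simp add: matrix_arith scaleR_2)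
    ultimately show ?thesis by (simp add: matrix_arith)
  qed
  define C where "C = 2 * norm (mat 1 :: real ^ 'n ^ 'n) * norm Z * norm (N 1)"
  show ?thesis
  proof (rule that[of Z q C])
    show "norm (q t - Q) \<le> C * \<bar>t - 1\<bar>" for t
    proof -
      \<comment> \<open>Multiplication by \<open>mat 1 - Z\<close> clears the denominator of
        \<open>Q\<close>, exposing the factor \<open>t - 1\<close>; the remaining factors are
        bounded because orthogonal matrices all have the same norm.\<close>
      have "(q t - Q) ** (mat 1 - Z) = q t ** (mat 1 - t *\<^sub>R Z) + (t - 1) *\<^sub>R (q t ** Z) - Q ** (mat 1 - Z)"
        by (simp add: matrix_arith algebra_simps)
      also have "\<dots> = (t - 1) *\<^sub>R ((mat 1 + q t) ** Z)"
        unfolding q Q1' by (simp add: matrix_arith algebra_simps)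
      finally have "(q t - Q) ** (mat 1 - Z) ** N 1 = (t - 1) *\<^sub>R ((mat 1 + q t) ** Z ** N 1)"
        by (simp add: matrix_scaleR_left)
      moreover have "(mat 1 - Z) ** N 1 = mat 1" using N(1)[of 1] by simp
      ultimately have "q t - Q = (t - 1) *\<^sub>R ((mat 1 + q t) ** Z ** N 1)"
        by (metis matrix_mul_assoc matrix_mul_rid)
      then have "norm (q t - Q) = \<bar>t - 1\<bar> * norm ((mat 1 + q t) ** Z ** N 1)" by simp
      also have "\<dots> \<le> \<bar>t - 1\<bar> * (norm (mat 1 + q t) * norm Z * norm (N 1))"
        by (intro mult_left_mono abs_ge_zero)
           (meson norm_matrix_mult_le mult_right_mono norm_ge_zero order_trans)
      also have "\<dots> \<le> \<bar>t - 1\<bar> * C"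
        unfolding C_def using norm_triangle_ineq[of "mat 1" "q t"] norm_orthogonal_matrix[OF oq[of t]]
        by (intro mult_left_mono mult_right_mono) auto
      finally show ?thesis by (simp add: mult.commute)
    qed
    show "g ** q t = q t ** g" if "g ** Q = Q ** g" for g t
    proof -
      have gZ: "g ** Z = Z ** g"
        unfolding Z_def using that Wcom[OF that]
        by (simp add: matrix_arith) (metis matrix_mul_assoc)
      have "g ** N t = N t ** g"
      proof -
        have "g ** (mat 1 - t *\<^sub>R Z) = (mat 1 - t *\<^sub>R Z) ** g" using gZ by (simp add: matrix_arith)
        then show ?thesis by (metis N matrix_mul_assoc matrix_mul_lid matrix_mul_rid)
      qed
      moreover have "g ** (mat 1 + t *\<^sub>R Z) = (mat 1 + t *\<^sub>R Z) ** g" using gZ by (simp add: matrix_arith)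
      ultimately show ?thesis unfolding q_def by (metis matrix_mul_assoc)
    qed
  qed (use tZ oq q in auto)
qed

text \<open>The determinant is a polynomial in \<open>t\<close> that does not vanish at 0.\<close>

lemma finite_singular_pencil:
  fixes X Y :: "real ^ 'n ^ 'n"
  assumes "det X \<noteq> 0"
  shows "finite {t. det (X + t *\<^sub>R Y) = 0}"
proof -
  have entry: "real_polynomial_function (\<lambda>t. a + t * b)" for a b :: real
    by (rule real_polynomial_function.intros(3)[OF real_polynomial_function.intros(2)
          real_polynomial_function.intros(1)[OF bounded_linear_mult_left]])
  have "real_polynomial_function (\<lambda>t. det (X + t *\<^sub>R Y))"
    unfolding det_def
    by (intro real_polynomial_function_sum real_polynomial_function_prod finite_permutations finite
          real_polynomial_function.intros(4)[OF real_polynomial_function.intros(2)])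
       (simp add: entry)
  then obtain a n where p: "(\<lambda>t. det (X + t *\<^sub>R Y)) = (\<lambda>t. \<Sum>i\<le>n. a i * t ^ i)"
    using real_polynomial_function_imp_sum by blast
  have "det (X + 0 *\<^sub>R Y) \<noteq> 0" using assms by simp
  then have "\<exists>i\<le>n. a i \<noteq> 0" using fun_cong[OF p, of 0] by (metis (mono_tags, lifting) atMost_iff mult_zero_left sum.neutral)
  then have "finite {t. (\<Sum>i\<le>n. a i * t ^ i) = 0}"
    using polyfun_finite_roots[of a n] by blast
  then show ?thesis using p by (simp add: fun_eq_iff)
qed

section \<open>Density of nondegenerate pairs\<close>

lemma rank_orthogonal_conj:
  fixes S :: "real ^ 'n ^ 'n"
  assumes "orthogonal_matrix U" shows "rank (U ** S ** transpose U) = rank S"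
proof (rule antisym)
  show "rank (U ** S ** transpose U) \<le> rank S"
    by (meson rank_mul_le_left rank_mul_le_right le_trans)
  have "transpose U ** (U ** S ** transpose U) ** U = (transpose U ** U) ** S ** (transpose U ** U)"
    by (simp only: matrix_mul_assoc)
  then have "S = transpose U ** (U ** S ** transpose U) ** U"
    using assms by (simp add: orthogonal_matrix_def)
  then show "rank S \<le> rank (U ** S ** transpose U)"
    by (metis rank_mul_le_left rank_mul_le_right le_trans)
qed

lemma norm_conj_diff_le:
  fixes S U :: "real ^ 'n ^ 'n"
  shows "norm (U ** S ** transpose U - S) \<le> norm (U - mat 1) * norm S * (norm U + 1)"
proof -
  have "U ** S ** transpose U - S = (U - mat 1) ** S ** transpose U + S ** transpose (U - mat 1)"
    by (simp add: matrix_arith)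
  also have "norm \<dots> \<le> norm ((U - mat 1) ** S ** transpose U) + norm (S ** transpose (U - mat 1))"
    by (rule norm_triangle_ineq)
  also have "\<dots> \<le> norm (U - mat 1) * norm S * norm U + norm S * norm (U - mat 1)"
  proof (rule add_mono)
    show "norm ((U - mat 1) ** S ** transpose U) \<le> norm (U - mat 1) * norm S * norm U"
      by (rule order_trans[OF norm_matrix_mult_le])
         (simp add: norm_transpose mult_right_mono norm_matrix_mult_le)
    show "norm (S ** transpose (U - mat 1)) \<le> norm S * norm (U - mat 1)"
      using norm_matrix_mult_le[of S "transpose (U - mat 1)"] by (simp add: norm_transpose)
  qed
  finally show ?thesis by (simp add: algebra_simps)
qed

context graded_symmetry
begin

lemma stratum_odd: "S \<in> stratum k \<Longrightarrow> S \<in> odd_mats"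
  by (simp add: stratum_def)

lemma range_proj_isotropic:
  assumes S: "S \<in> odd_mats" and P: "is_range_proj P (pos_part S)"
  shows "P ** J ** P = 0"
proof -
  obtain L where L: "P = pos_part S ** L" using P by (auto simp: is_range_proj_def)
  have "P = transpose L ** pos_part S"
    using is_range_projD(1)[OF P] psd_transpose[OF psd_pos_part, of S]
    by (metis L matrix_transpose_mul)
  then have "P ** J ** P = transpose L ** (pos_part S ** J ** pos_part S) ** L"
    using L by (metis matrix_mul_assoc)
  then show ?thesis by (simp add: pos_part_isotropic[OF S])
qed

lemma stratum_conj:
  assumes S: "S \<in> stratum k" and U: "orthogonal_matrix U" "J ** U = U ** J" "\<And>g. g \<in> G \<Longrightarrow> g ** U = U ** g"
  shows "U ** S ** transpose U \<in> stratum k"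
proof -
  have UU: "transpose U ** U = mat 1" "U ** transpose U = mat 1"
    using U(1) by (auto simp: orthogonal_matrix_def)
  have tr: "h ** transpose U = transpose U ** h" if "h ** U = U ** h" for h
    using that by (metis UU matrix_mul_assoc matrix_mul_lid matrix_mul_rid)
  have "J ** (U ** S ** transpose U) ** J = U ** (J ** S ** J) ** transpose U"
    using tr[OF U(2)] U(2) by (metis matrix_mul_assoc)
  then have "J ** (U ** S ** transpose U) ** J = - (U ** S ** transpose U)"
    using S by (simp add: stratum_def odd_mats_def matrix_minus_left matrix_minus_right)
  moreover have "g ** (U ** S ** transpose U) = U ** S ** transpose U ** g" if "g \<in> G" for g
  proof -
    have "g ** S = S ** g" using S that by (simp add: stratum_def odd_mats_def)
    then show ?thesis using tr[OF U(3)[OF that]] U(3)[OF that] by (metis matrix_mul_assoc)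
  qed
  ultimately show ?thesis
    using S rank_orthogonal_conj[OF U(1)] unfolding stratum_def odd_mats_def
    by (simp add: matrix_transpose_mul matrix_mul_assoc)
qed

text \<open>The ranges of \<open>P\<close>, of \<open>J ** P ** J\<close> and their common orthogonal complement decompose the space.
  Adding up the projections from one decomposition to the other gives \<open>M\<close>, whose orthogonal polar
  factor intertwines the two decompositions.\<close>

lemma close_ranges_intertwined:
  obtains d where "0 < d"
    "\<And>S S' P P'. S \<in> odd_mats \<Longrightarrow> S' \<in> odd_mats \<Longrightarrow> is_range_proj P (pos_part S) \<Longrightarrow>
       is_range_proj P' (pos_part S') \<Longrightarrow> norm (P' - P) < d \<Longrightarrow>
       \<exists>Q. orthogonal_matrix Q \<and> J ** Q = Q ** J \<and> (\<forall>g\<in>G. g ** Q = Q ** g) \<and> P' ** Q = Q ** P \<and>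
         (\<forall>x. Q *v x = - x \<longrightarrow> x = 0)"
proof -
  define c where "c = norm (mat 1 :: real ^ 'h ^ 'h)"
  have c: "0 \<le> c" by (simp add: c_def)
  show ?thesis
  \<comment> \<open>The estimate of \<open>M - mat 1\<close> below adds up to
    \<open>8 * c * d\<close>: two terms \<open>d * c\<close> and one
    \<open>(2 * d) * (3 * c)\<close>.\<close>
  proof (rule that[of "1 / (8 * c + 1)"])
    show "0 < 1 / (8 * c + 1)" using c by simp
    fix S S' P P' :: "real ^ 'h ^ 'h"
    assume S: "S \<in> odd_mats" "S' \<in> odd_mats" and P: "is_range_proj P (pos_part S)"
      "is_range_proj P' (pos_part S')" and close: "norm (P' - P) < 1 / (8 * c + 1)"
    define d where "d = norm (P' - P)"
    have d: "0 \<le> d" "8 * c * d < 1"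
    proof -
      show "0 \<le> d" by (simp add: d_def)
      have "d * (8 * c + 1) < 1" using close c by (simp add: d_def pos_less_divide_eq)
      then show "8 * c * d < 1" using \<open>0 \<le> d\<close> by (simp add: algebra_simps)
    qed
    define N N' R R' where "N = J ** P ** J" and "N' = J ** P' ** J"
      and "R = mat 1 - P - N" and "R' = mat 1 - P' - N'"
    have idem: "P ** P = P" "P' ** P' = P'" and sym: "transpose P = P" "transpose P' = P'"
      using P is_range_projD by auto
    have PN: "P ** N = 0" "N ** P = 0" "P' ** N' = 0" "N' ** P' = 0"
      using range_proj_isotropic[OF S(1) P(1)] range_proj_isotropic[OF S(2) P(2)]
      by (simp_all add: N_def N'_def matrix_mul_assoc)
         (metis matrix_mul_assoc matrix_mult_zero_right)+
    have NN: "N ** N = N" "N' ** N' = N'"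
      unfolding N_def N'_def using idem by (metis J_inv matrix_mul_assoc matrix_mul_rid)+
    have JN: "J ** P = N ** J" "J ** N = P ** J" "J ** P' = N' ** J" "J ** N' = P' ** J"
      unfolding N_def N'_def by (metis J_inv matrix_mul_assoc matrix_mul_lid matrix_mul_rid)+
    have JR: "J ** R = R ** J" "J ** R' = R' ** J"
      using JN by (simp_all add: R_def R'_def matrix_arith)
    have PR: "P ** R = 0" "R ** P = 0" "P' ** R' = 0" "R' ** P' = 0" "R ** R = R" "N ** R = 0"
      by (simp_all add: R_def R'_def matrix_arith PN idem NN)
    define M where "M = P' ** P + N' ** N + R' ** R"
    have JM: "J ** M = M ** J"
    proof -
      have "J ** (P' ** P) = N' ** N ** J" "J ** (N' ** N) = P' ** P ** J" "J ** (R' ** R) = R' ** R ** J"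
        using JN JR by (metis matrix_mul_assoc)+
      then show ?thesis by (simp add: M_def matrix_add_ldistrib matrix_add_rdistrib add.commute)
    qed
    have gM: "g ** M = M ** g" if "g \<in> G" for g
    proof -
      have gP: "g ** P = P ** g" "g ** P' = P' ** g"
        using range_proj_commute[OF _ G_orthogonal[OF that] pos_part_commute[OF _ that]] P S by auto
      have gN: "g ** N = N ** g" "g ** N' = N' ** g"
      proof -
        have *: "g ** (J ** B ** J) = J ** B ** J ** g" if "g ** B = B ** g" for B
          using G_J[OF \<open>g \<in> G\<close>]
        proof
          assume "g ** J = J ** g"
          then show ?thesis using that by (metis matrix_mul_assoc)
        next
          assume gJ: "g ** J = - (J ** g)"
          have "g ** (J ** B ** J) = (g ** J) ** B ** J" by (simp only: matrix_mul_assoc)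
          also have "\<dots> = - (J ** (g ** B) ** J)"
            by (simp only: gJ matrix_minus_left matrix_mul_assoc)
          also have "\<dots> = - (J ** B ** (g ** J))" by (simp only: that matrix_mul_assoc)
          also have "\<dots> = J ** B ** J ** g"
            by (simp only: gJ matrix_minus_right matrix_mul_assoc minus_minus)
          finally show ?thesis .
        qed
        show "g ** N = N ** g" "g ** N' = N' ** g" unfolding N_def N'_def using * gP by auto
      qed
      have gR: "g ** R = R ** g" "g ** R' = R' ** g"
        using gP gN by (simp_all add: R_def R'_def matrix_arith)
      have "g ** (P' ** P) = P' ** P ** g" "g ** (N' ** N) = N' ** N ** g" "g ** (R' ** R) = R' ** R ** g"
        using gP gN gR by (metis matrix_mul_assoc)+
      then show ?thesis by (simp add: M_def matrix_add_ldistrib matrix_add_rdistrib)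
    qed
    have PM: "P' ** M = P' ** P" "M ** P = P' ** P"
    proof -
      have "P' ** (N' ** N) = 0" "P' ** (R' ** R) = 0" "P' ** (P' ** P) = P' ** P"
        using PN PR idem by (metis matrix_mul_assoc matrix_mult_zero_left)+
      then show "P' ** M = P' ** P" by (simp add: M_def matrix_add_ldistrib)
      have "(N' ** N) ** P = 0" "(R' ** R) ** P = 0" "(P' ** P) ** P = P' ** P"
        using PN PR idem by (metis matrix_mul_assoc matrix_mult_zero_right)+
      then show "M ** P = P' ** P" by (simp add: M_def matrix_add_rdistrib)
    qed
    \<comment> \<open>The intertwining property of the polar factor concerns orthogonal matrices, so
      the projections are replaced by the reflections \<open>mat 1 - 2 P\<close>.\<close>
    define F F' where "F = mat 1 - P - P" and "F' = mat 1 - P' - P'"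
    have F: "orthogonal_matrix F" "orthogonal_matrix F'"
    proof -
      have *: "orthogonal_matrix (mat 1 - B - B)" if "transpose B = B" "B ** B = B" for B :: "real ^ 'h ^ 'h"
      proof -
        have "transpose (mat 1 - B - B) = mat 1 - B - B"
          by (simp only: transpose_diff transpose_mat that)
        moreover have "(mat 1 - B - B) ** (mat 1 - B - B) = mat 1"
          unfolding matrix_diff_ldistrib matrix_diff_rdistrib matrix_mul_lid matrix_mul_rid that by simp
        ultimately show ?thesis unfolding orthogonal_matrix_def by simp
      qed
      show "orthogonal_matrix F" "orthogonal_matrix F'"
        unfolding F_def F'_def using * sym idem by auto
    qed
    have FM: "F' ** M = M ** F"
      by (simp only: F_def F'_def matrix_diff_ldistrib matrix_diff_rdistrib matrix_mul_lid
          matrix_mul_rid PM)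
    have nM: "norm (M - mat 1) < 1"
    proof -
      \<comment> \<open>An orthogonal projection is orthogonal to its complement, so its norm is at
        most that of the identity.\<close>
      have nproj: "norm B \<le> c" if "is_range_proj B C" for B C :: "real ^ 'h ^ 'h"
      proof (rule power2_le_imp_le)
        have "0 \<le> (mat 1 - B) \<bullet> (mat 1 - B)" by simp
        moreover have "mat 1 \<bullet> B = B \<bullet> B"
          using is_range_projD[OF that]
          by (metis inner_matrix_mult_right inner_commute matrix_mul_lid)
        ultimately show "(norm B)\<^sup>2 \<le> c\<^sup>2"
          by (simp add: c_def power2_norm_eq_inner inner_diff_left inner_diff_right inner_commute)
      qed (rule c)
      have nP: "norm P \<le> c" "norm N \<le> c" using nproj[OF P(1)] by (simp_all add: N_def norm_J)
      have nR: "norm R \<le> 3 * c"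
        using norm_triangle_ineq4[of "mat 1" P] norm_triangle_ineq4[of "mat 1 - P" N] nP
        by (simp add: R_def c_def)
      have nNd: "norm (N' - N) = d"
      proof -
        have "N' - N = J ** (P' - P) ** J" by (simp add: N_def N'_def matrix_arith)
        then show ?thesis by (simp add: norm_J d_def)
      qed
      have "mat 1 = P ** P + N ** N + R ** R" unfolding idem NN PR by (simp add: R_def)
      then have "M - mat 1 = (P' - P) ** P + (N' - N) ** N + (R' - R) ** R"
        by (simp only: M_def) (simp add: matrix_diff_rdistrib algebra_simps)
      also have "R' - R = - ((P' - P) + (N' - N))" by (simp add: R_def R'_def)
      finally have "M - mat 1 = (P' - P) ** P + (N' - N) ** N - ((P' - P) + (N' - N)) ** R"
        by (simp only: matrix_minus_left) simp
      then have "norm (M - mat 1) = norm ((P' - P) ** P + (N' - N) ** N - ((P' - P) + (N' - N)) ** R)"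
        by simp
      also have "\<dots> \<le> norm ((P' - P) ** P) + norm ((N' - N) ** N) + norm (((P' - P) + (N' - N)) ** R)"
        by (meson add_right_mono norm_triangle_ineq norm_triangle_ineq4 order_trans)
      also have "\<dots> \<le> d * c + d * c + (2 * d) * (3 * c)"
      proof (intro add_mono)
        show "norm ((P' - P) ** P) \<le> d * c"
          unfolding d_def using nP by (intro order_trans[OF norm_matrix_mult_le] mult_mono) auto
        show "norm ((N' - N) ** N) \<le> d * c"
          using nP nNd d by (intro order_trans[OF norm_matrix_mult_le] mult_mono) auto
        show "norm (((P' - P) + (N' - N)) ** R) \<le> (2 * d) * (3 * c)"
          using nR d norm_triangle_ineq[of "P' - P" "N' - N"] nNd
          by (intro order_trans[OF norm_matrix_mult_le] mult_mono) (auto simp: d_def)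
      qed
      also have "\<dots> < 1" using d by (simp add: algebra_simps)
      finally show ?thesis .
    qed
    have Mpos: "0 < x \<bullet> (M *v x)" if "x \<noteq> 0" for x
    proof -
      have "\<bar>x \<bullet> ((M - mat 1) *v x)\<bar> \<le> norm x * (norm (M - mat 1) * norm x)"
        by (meson Cauchy_Schwarz_ineq2 mult_left_mono norm_ge_zero norm_matrix_vector_le order_trans)
      also have "\<dots> < norm x * (1 * norm x)"
        using nM that by (intro mult_strict_left_mono mult_strict_right_mono) auto
      finally have "- (x \<bullet> x) < x \<bullet> ((M - mat 1) *v x)"
        by (simp add: dot_square_norm power2_eq_square)
      then show ?thesis by (simp add: matrix_vector_arith inner_diff_right)
    qed
    then have "\<And>x. M *v x = 0 \<Longrightarrow> x = 0" by (metis inner_zero_right less_irrefl)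
    then have "invertible M" unfolding invertible_def by (metis invertible_of_kernel)
    then obtain E Q where E: "psd E" "orthogonal_matrix Q" "M = E ** Q"
      and com: "\<And>g h. orthogonal_matrix g \<Longrightarrow> orthogonal_matrix h \<Longrightarrow> g ** M = M ** h \<Longrightarrow> g ** Q = Q ** h"
      using polar_decomposition by metis
    show "\<exists>Q. orthogonal_matrix Q \<and> J ** Q = Q ** J \<and> (\<forall>g\<in>G. g ** Q = Q ** g) \<and> P' ** Q = Q ** P \<and>
         (\<forall>x. Q *v x = - x \<longrightarrow> x = 0)"
    proof (intro exI[of _ Q] conjI ballI allI impI)
      show "orthogonal_matrix Q" by (rule E(2))
      show "J ** Q = Q ** J" by (rule com[OF J_orthogonal J_orthogonal JM])
      show "g ** Q = Q ** g" if "g \<in> G" for g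
        by (rule com[OF G_orthogonal[OF that] G_orthogonal[OF that] gM[OF that]])
      have "F' ** Q = Q ** F" by (rule com[OF F(2,1) FM])
      then have "Q - P' ** Q - P' ** Q = Q - Q ** P - Q ** P"
        by (simp only: F_def F'_def matrix_diff_ldistrib matrix_diff_rdistrib matrix_mul_lid matrix_mul_rid)
      moreover have "B = D" if "A - B - B = A - D - D" for A B D :: "real ^ 'h ^ 'h"
        using that by (simp add: vec_eq_iff)
      ultimately show "P' ** Q = Q ** P" by blast
      \<comment> \<open>The form of \<open>M\<close> is positive definite, but an eigenvector of
        \<open>Q\<close> for -1 would give \<open>M *v x = - (E *v x)\<close> with \<open>E\<close>
        positive semidefinite.\<close>
      fix x assume x: "Q *v x = - x"
      have "M *v x = - (E *v x)"
        unfolding E(3) by (simp add: x matrix_vector_minus_right flip: matrix_vector_mul_assoc)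
      then show "x = 0" using Mpos[of x] psd_nonneg[OF E(1), of x] by fastforce
    qed
  qed
qed

text \<open>A vector in the range of \<open>P\<close> is killed by \<open>pos_part B\<close> exactly
  if it is orthogonal to the image under \<open>P\<close> of the range of \<open>pos_part B\<close>.
  So this says that \<open>P\<close> maps that range onto its own.\<close>

definition nondegenerate :: "real ^ 'h ^ 'h \<Rightarrow> real ^ 'h ^ 'h \<Rightarrow> bool"
  where "nondegenerate A B \<longleftrightarrow> (\<forall>P x. is_range_proj P (pos_part A) \<longrightarrow> pos_part B *v (P *v x) = 0 \<longrightarrow> P *v x = 0)"

lemma nondegenerate_refl:
  assumes "A \<in> odd_mats" shows "nondegenerate A A"
  unfolding nondegenerate_def
proof (intro allI impI)
  fix P x assume P: "is_range_proj P (pos_part A)" and x: "pos_part A *v (P *v x) = 0"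
  have "P *v (P *v x) = 0"
    using x range_proj_null[OF P psd_transpose[OF psd_pos_part]] by blast
  then show "P *v x = 0" by (simp add: matrix_vector_mul_assoc is_range_projD(2)[OF P])
qed

lemma joined_within_of_nondegenerate:
  assumes "A \<in> stratum k" "B \<in> stratum k" "nondegenerate A B"
  shows "joined_within (stratum k) A B (sqrt 6 * dist A B)"
proof -
  obtain P where "is_range_proj P (pos_part A)" using range_proj_exists by blast
  then show ?thesis
    using joined_within_nondegenerate[OF assms(1,2)] assms(3) unfolding nondegenerate_def by blast
qed

lemma range_proj_lipschitz_stratum:
  assumes S: "S \<in> stratum k" and P: "is_range_proj P (pos_part S)"
  obtains C where "0 < C"
    "\<And>S' P'. S' \<in> stratum k \<Longrightarrow> is_range_proj P' (pos_part S') \<Longrightarrow> norm (P' - P) \<le> C * dist S' S"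
proof -
  obtain C where C: "0 < C"
    "\<And>K' P'. is_range_proj P' K' \<Longrightarrow> transpose K' = K' \<Longrightarrow> rank K' = rank (pos_part S) \<Longrightarrow>
       norm (P' - P) \<le> C * norm (K' - pos_part S)"
    using range_proj_lipschitz_at[OF P psd_transpose[OF psd_pos_part]] by metis
  show ?thesis
  proof (rule that[OF C(1)])
    fix S' P' assume S': "S' \<in> stratum k" and P': "is_range_proj P' (pos_part S')"
    have "2 * (norm (pos_part S' - pos_part S))\<^sup>2 \<le> (norm (S' - S))\<^sup>2"
      by (rule norm_pos_part_diff) (use S S' stratum_odd in auto)
    then have "(norm (pos_part S' - pos_part S))\<^sup>2 \<le> (dist S' S)\<^sup>2"
      using zero_le_power2[of "norm (pos_part S' - pos_part S)"] unfolding dist_norm by linarith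
    then have "norm (pos_part S' - pos_part S) \<le> dist S' S"
      by (rule power2_le_imp_le) simp
    moreover have "rank (pos_part S') = rank (pos_part S)"
      using S S' rank_pos_part by (auto simp: stratum_def)
    ultimately show "norm (P' - P) \<le> C * dist S' S"
      using C(2)[OF P' psd_transpose[OF psd_pos_part]] C(1)
        mult_left_mono[of "norm (pos_part S' - pos_part S)" "dist S' S" C] by linarith
  qed
qed

text \<open>A vector fixed by \<open>P\<close> and killed by \<open>Q\<close> is fixed by
  \<open>P - Q\<close>.\<close>

lemma nondegenerate_of_close:
  assumes P: "is_range_proj P (pos_part A)" "is_range_proj Q (pos_part B)" and close: "norm (P - Q) < 1"
  shows "nondegenerate A B"
  unfolding nondegenerate_def
proof (intro allI impI)
  fix P' x assume "is_range_proj P' (pos_part A)" and x: "pos_part B *v (P' *v x) = 0"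
  then have P': "P' = P" using range_proj_unique P(1) by blast
  define y where "y = P' *v x"
  have "Q *v y = 0"
    using x range_proj_null[OF P(2) psd_transpose[OF psd_pos_part]] by (simp add: y_def)
  moreover have "P *v y = y"
    by (simp add: y_def P' matrix_vector_mul_assoc is_range_projD(2)[OF P(1)])
  ultimately have "norm y = norm ((P - Q) *v y)" by (simp add: matrix_vector_arith)
  also have "\<dots> \<le> norm (P - Q) * norm y" by (rule norm_matrix_vector_le)
  finally have "norm y * (1 - norm (P - Q)) \<le> 0" by (simp add: algebra_simps)
  then show "P' *v x = 0" using close by (simp add: mult_le_0_iff y_def)
qed

end

section \<open>Density of good matrices in a component and the resulting length bound\<close>

context graded_symmetry
begin

text \<open>Every \<open>S''\<close> near \<open>S'\<close> lies on the curve of conjugates of \<open>S''\<close> along which the range of the positive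
  part moves from that of \<open>S'\<close> to that of \<open>S''\<close>. On this curve nondegeneracy is the nonvanishing of
  a determinant that is polynomial in the parameter, and it holds at parameter \<open>0\<close>.\<close>

lemma nondegenerate_dense_near:
  assumes A: "A \<in> stratum k" and S': "S' \<in> stratum k" and nd: "nondegenerate A S'"
    and S'': "S'' \<in> stratum k"
    and P': "is_range_proj P' (pos_part S')" and P'': "is_range_proj P'' (pos_part S'')"
    and Q: "orthogonal_matrix Q" "J ** Q = Q ** J" "\<And>g. g \<in> G \<Longrightarrow> g ** Q = Q ** g" "P'' ** Q = Q ** P'"
      "\<And>x. Q *v x = - x \<Longrightarrow> x = 0"
    and e: "0 < e"
  shows "\<exists>S. S \<in> stratum k \<and> nondegenerate A S \<and> dist S S'' < e"
proof -
  obtain Z q C where Z: "transpose Z = - Z" and oq: "\<And>t. orthogonal_matrix (q t)"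
    and q: "\<And>t. q t ** (mat 1 - t *\<^sub>R Z) = mat 1 + t *\<^sub>R Z"
    and qC: "\<And>t. norm (q t - Q) \<le> C * \<bar>t - 1\<bar>"
    and qcom: "\<And>g t. g ** Q = Q ** g \<Longrightarrow> g ** q t = q t ** g"
    using cayley_curve[OF Q(1,5)] by metis
  obtain P where P: "is_range_proj P (pos_part A)" using range_proj_exists by blast
  have idem: "P ** P = P" "P' ** P' = P'" and sym: "transpose P = P" "transpose P' = P'"
    using P P' is_range_projD by auto
  \<comment> \<open>The matrix \<open>P ** P' ** transpose (q t) + (mat 1 - P)\<close> multiplied by
    \<open>mat 1 + t *\<^sub>R Z\<close>: the denominator of the Cayley transform disappears and a
    pencil linear in \<open>t\<close> remains.\<close>
  define X Y where "X = P ** P' + (mat 1 - P)" and "Y = (mat 1 - P) ** Z - P ** P' ** Z"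
  have XY: "X + t *\<^sub>R Y = P ** P' ** (mat 1 - t *\<^sub>R Z) + (mat 1 - P) ** (mat 1 + t *\<^sub>R Z)" for t
    by (simp add: X_def Y_def matrix_arith scaleR_diff_right)
  have "w = 0" if w: "X *v w = 0" for w
  proof -
    have PX: "P ** X = P ** P'"
      by (simp add: X_def matrix_arith idem)
    have 1: "(P ** P') *v w = 0" using w PX by (metis matrix_vector_mul_assoc matrix_vector_mult_0_right)
    then have 2: "P *v w = w"
      using w by (simp add: X_def matrix_vector_arith)
    have "(P' *v w) \<bullet> (P' *v w) = w \<bullet> (P' *v w)"
      by (metis idem(2) inner_matrix_vector matrix_vector_mul_assoc sym(2))
    also have "\<dots> = (P *v w) \<bullet> (P' *v w)" by (simp add: 2)
    also have "\<dots> = w \<bullet> ((P ** P') *v w)" by (metis inner_matrix_vector matrix_vector_mul_assoc sym(1))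
    finally have "P' *v w = 0" using 1 by simp
    then have "pos_part S' *v (P *v w) = 0"
      using 2 range_proj_null[OF P' psd_transpose[OF psd_pos_part]] by simp
    then show ?thesis using nd P 2 unfolding nondegenerate_def by metis
  qed
  then have "det X \<noteq> 0"
    by (metis invertible_det_nz invertible_def invertible_of_kernel)
  then have fin: "finite {t. det (X + t *\<^sub>R Y) = 0}" by (rule finite_singular_pencil)
  define c where "c = norm (mat 1 :: real ^ 'h ^ 'h)"
  have c: "0 \<le> c" by (simp add: c_def)
  \<comment> \<open>Chosen so that the conjugate at parameter \<open>t\<close> lies within
    \<open>(1 - t) * (D - 1)\<close> of \<open>S''\<close>; the extra 1 ensures positivity.\<close>
  define D where "D = \<bar>C\<bar> * c * norm S'' * (c + 1) + 1"
  have D: "0 < D" using c by (auto simp: D_def intro!: add_nonneg_pos)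
  have "infinite {1 - e / D<..<1}" using e D by (simp add: infinite_Ioo)
  then obtain t where t: "t \<in> {1 - e / D<..<1}" "det (X + t *\<^sub>R Y) \<noteq> 0"
    using fin by (metis (mono_tags, lifting) finite_subset mem_Collect_eq subsetI)
  have inj: "w = 0" if "(X + t *\<^sub>R Y) *v w = 0" for w
  proof -
    have "invertible (X + t *\<^sub>R Y)" using t(2) by (simp add: invertible_det_nz)
    then show ?thesis using that by (metis invertible_def matrix_left_invertible_ker)
  qed
  \<comment> \<open>First undo \<open>Q\<close>, which takes the range of \<open>P''\<close> back to
    that of \<open>P'\<close>, then rotate forward only up to \<open>q t\<close>.\<close>
  define U where "U = q t ** transpose Q"
  have QQ: "transpose Q ** Q = mat 1" "Q ** transpose Q = mat 1"
    using Q(1) by (auto simp: orthogonal_matrix_def)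
  have U: "orthogonal_matrix U"
    unfolding U_def using oq Q(1) by (simp add: orthogonal_matrix_mul orthogonal_matrix_transpose)
  have Ucom: "h ** U = U ** h" if "h ** Q = Q ** h" for h
  proof -
    have "h ** transpose Q = transpose Q ** h"
      using that QQ by (metis matrix_mul_assoc matrix_mul_lid matrix_mul_rid)
    then show ?thesis using qcom[OF that, of t] unfolding U_def by (metis matrix_mul_assoc)
  qed
  define S where "S = U ** S'' ** transpose U"
  have S: "S \<in> stratum k"
    unfolding S_def by (rule stratum_conj[OF S'' U Ucom Ucom]) (use Q in auto)
  have "U ** P'' ** transpose U = q t ** (transpose Q ** (P'' ** Q)) ** transpose (q t)"
    by (simp add: U_def matrix_transpose_mul matrix_mul_assoc)
  also have "transpose Q ** (P'' ** Q) = P'"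
    by (simp add: Q(4) matrix_mul_assoc QQ)
  finally have "is_range_proj (q t ** P' ** transpose (q t)) (pos_part S)"
    using range_proj_orthogonal_conj[OF P'' U] pos_part_orthogonal[OF odd_transpose[OF stratum_odd[OF S'']] U]
    by (simp add: S_def)
  note PS = this
  have "nondegenerate A S"
    unfolding nondegenerate_def
  proof (intro allI impI)
    fix P0 x assume "is_range_proj P0 (pos_part A)" and x: "pos_part S *v (P0 *v x) = 0"
    then have P0: "P0 = P" using range_proj_unique P by blast
    define a where "a = P *v x"
    have Pa: "P *v a = a" by (simp add: a_def matrix_vector_mul_assoc idem)
    have qq: "transpose (q t) ** q t = mat 1" using oq by (simp add: orthogonal_matrix_def)
    have "(q t ** P' ** transpose (q t)) *v a = 0"
      using x range_proj_null[OF PS psd_transpose[OF psd_pos_part]] by (simp add: a_def P0)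
    then have "(transpose (q t) ** (q t ** P' ** transpose (q t))) *v a = 0"
      by (metis matrix_vector_mul_assoc matrix_vector_mult_0_right)
    then have 1: "(P' ** transpose (q t)) *v a = 0"
      using qq by (simp add: matrix_mul_assoc)
    obtain N where N: "(mat 1 + t *\<^sub>R Z) ** N = mat 1"
      using invertible_of_kernel skew_pencil_kernel[OF Z] by metis
    define w where "w = N *v a"
    have w: "(mat 1 + t *\<^sub>R Z) *v w = a" by (simp add: w_def matrix_vector_mul_assoc N)
    have "(mat 1 - t *\<^sub>R Z) *v w = (transpose (q t) ** (q t ** (mat 1 - t *\<^sub>R Z))) *v w"
      by (simp add: matrix_mul_assoc qq)
    also have "\<dots> = transpose (q t) *v a"
      unfolding q using w by (metis matrix_vector_mul_assoc)
    finally have "(mat 1 - t *\<^sub>R Z) *v w = transpose (q t) *v a" .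
    then have "(P ** P' ** (mat 1 - t *\<^sub>R Z)) *v w = 0"
      using 1 by (metis matrix_mul_assoc matrix_vector_mul_assoc matrix_vector_mult_0_right)
    moreover have "((mat 1 - P) ** (mat 1 + t *\<^sub>R Z)) *v w = 0"
      using w Pa by (simp add: matrix_vector_arith flip: matrix_vector_mul_assoc)
    ultimately have "(X + t *\<^sub>R Y) *v w = 0"
      unfolding XY by (simp only: matrix_vector_mult_add_rdistrib) simp
    then have "w = 0" by (rule inj)
    then show "P0 *v x = 0" using w by (simp add: a_def P0)
  qed
  moreover have "dist S S'' < e"
  proof -
    have "U - mat 1 = (q t - Q) ** transpose Q" by (simp add: U_def matrix_arith QQ)
    then have "norm (U - mat 1) \<le> norm (q t - Q) * c"
      using norm_matrix_mult_le[of "q t - Q" "transpose Q"]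
      by (simp add: norm_transpose norm_orthogonal_matrix[OF Q(1)] c_def)
    also have "\<dots> \<le> (\<bar>C\<bar> * (1 - t)) * c"
    proof (rule mult_right_mono[OF _ c])
      have "C * \<bar>t - 1\<bar> \<le> \<bar>C\<bar> * (1 - t)" using t(1) by (intro mult_mono) auto
      then show "norm (q t - Q) \<le> \<bar>C\<bar> * (1 - t)" using qC[of t] by linarith
    qed
    finally have nU: "norm (U - mat 1) \<le> \<bar>C\<bar> * (1 - t) * c" .
    have "dist S S'' \<le> norm (U - mat 1) * norm S'' * (norm U + 1)"
      unfolding dist_norm S_def by (rule norm_conj_diff_le)
    also have "\<dots> \<le> (\<bar>C\<bar> * (1 - t) * c) * norm S'' * (c + 1)"
      unfolding norm_orthogonal_matrix[OF U] c_def[symmetric] using nU c by (intro mult_right_mono) auto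
    also have "\<dots> = (1 - t) * (D - 1)" by (simp add: D_def algebra_simps)
    also have "\<dots> < (1 - t) * D" using t(1) by simp
    also have "\<dots> < e" using t(1) D by (simp add: field_simps)
    finally show ?thesis .
  qed
  ultimately show ?thesis using S by blast
qed

text \<open>One good \<open>S'\<close> close to \<open>S\<close> is enough for openness:
  \<open>nondegenerate_dense_near\<close> approximates every \<open>S''\<close> whose range is close
  to that of \<open>S'\<close>. The argument runs inside a connected set containing
  \<open>A\<close>, which is itself good.\<close>

lemma component_subset_closure:
  assumes A: "A \<in> stratum k" and AB: "connected_component (stratum k) A B"
  shows "B \<in> closure {S \<in> stratum k. nondegenerate A S}"
proof -
  let ?G = "{S \<in> stratum k. nondegenerate A S}"
  obtain T where T: "connected T" "T \<subseteq> stratum k" "A \<in> T" "B \<in> T"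
    using AB unfolding connected_component_def by blast
  obtain d where d: "0 < d" and move: "\<And>S S' P P'. S \<in> odd_mats \<Longrightarrow> S' \<in> odd_mats \<Longrightarrow> is_range_proj P (pos_part S) \<Longrightarrow>
       is_range_proj P' (pos_part S') \<Longrightarrow> norm (P' - P) < d \<Longrightarrow>
       \<exists>Q. orthogonal_matrix Q \<and> J ** Q = Q ** J \<and> (\<forall>g\<in>G. g ** Q = Q ** g) \<and> P' ** Q = Q ** P \<and>
         (\<forall>x. Q *v x = - x \<longrightarrow> x = 0)"
    using close_ranges_intertwined by metis
  have nbhd: "\<exists>r>0. \<forall>S''\<in>stratum k. dist S'' S < r \<longrightarrow> S'' \<in> closure ?G"
    if S: "S \<in> stratum k" "S \<in> closure ?G" for S
  proof -
    obtain P where P: "is_range_proj P (pos_part S)" using range_proj_exists by blast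
    obtain C where C: "0 < C"
      "\<And>S' P'. S' \<in> stratum k \<Longrightarrow> is_range_proj P' (pos_part S') \<Longrightarrow> norm (P' - P) \<le> C * dist S' S"
      using range_proj_lipschitz_stratum[OF S(1) P] by metis
    \<comment> \<open>Within this radius each range projection is \<open>d / 2\<close>-close to that
      at \<open>S\<close>, so those at \<open>S'\<close> and \<open>S''\<close> are
      \<open>d\<close>-close to each other.\<close>
    define r where "r = d / (2 * C)"
    have r: "0 < r" "C * r = d / 2" using d C(1) by (simp_all add: r_def)
    obtain S' where S': "S' \<in> stratum k" "nondegenerate A S'" "dist S' S < r"
      using S(2) r(1) unfolding closure_approachable by blast
    obtain P' where P': "is_range_proj P' (pos_part S')" using range_proj_exists by blast
    have close: "norm (P0 - P) < d / 2" if "S0 \<in> stratum k" "is_range_proj P0 (pos_part S0)" "dist S0 S < r" for S0 P0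
      using C(2)[OF that(1,2)] mult_strict_left_mono[OF that(3) C(1)] r(2) by linarith
    show ?thesis
    proof (intro exI[of _ r] conjI ballI impI)
      fix S'' assume S'': "S'' \<in> stratum k" "dist S'' S < r"
      obtain P'' where P'': "is_range_proj P'' (pos_part S'')" using range_proj_exists by blast
      have "norm (P'' - P') < d"
        using norm_triangle_ineq4[of "P'' - P" "P' - P"] close[OF S''(1) P'' S''(2)] close[OF S'(1) P' S'(3)]
        by simp
      then obtain Q where Q: "orthogonal_matrix Q" "J ** Q = Q ** J" "\<And>g. g \<in> G \<Longrightarrow> g ** Q = Q ** g"
        "P'' ** Q = Q ** P'" "\<And>x. Q *v x = - x \<Longrightarrow> x = 0"
        using move[OF stratum_odd[OF S'(1)] stratum_odd[OF S''(1)] P' P''] by blast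
      show "S'' \<in> closure ?G"
        unfolding closure_approachable
      proof (intro allI impI)
        fix e :: real assume "0 < e"
        then show "\<exists>y\<in>?G. dist y S'' < e"
          using nondegenerate_dense_near[OF A S'(1,2) S''(1) P' P'' Q] by blast
      qed
    qed (rule r(1))
  qed
  have "openin (top_of_set T) (T \<inter> closure ?G)"
    unfolding openin_euclidean_subtopology_iff
  proof (intro conjI ballI)
    fix S assume "S \<in> T \<inter> closure ?G"
    then obtain r where "r > 0" "\<forall>S''\<in>stratum k. dist S'' S < r \<longrightarrow> S'' \<in> closure ?G"
      using nbhd T(2) by blast
    then show "\<exists>e>0. \<forall>x'\<in>T. dist x' S < e \<longrightarrow> x' \<in> T \<inter> closure ?G"
      using T(2) by blast
  qed auto
  moreover have "closedin (top_of_set T) (T \<inter> closure ?G)"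
    by (simp add: closedin_closed_Int)
  moreover have "A \<in> T \<inter> closure ?G"
    using A T(3) nondegenerate_refl[OF stratum_odd[OF A]] closure_subset[of ?G] by blast
  ultimately have "T \<inter> closure ?G = T"
    using T(1) unfolding connected_clopen by blast
  then show ?thesis using T(4) by blast
qed

lemma stratum_joined_within:
  assumes AB: "connected_component (stratum k) A B"
  shows "joined_within (stratum k) A B (2 * sqrt 2 * dist A B)"
\<comment> \<open>For equal endpoints there is no slack for a detour, hence the constant
  path.\<close>
proof (cases "A = B")
  case True
  then show ?thesis
    using connected_component_in[OF AB] by (simp add: joined_within_refl)
next
  case False
  have A: "A \<in> stratum k" and B: "B \<in> stratum k" using connected_component_in[OF AB] by auto
  obtain P where P: "is_range_proj P (pos_part B)" using range_proj_exists by blast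
  obtain C where C: "0 < C"
    "\<And>S' P'. S' \<in> stratum k \<Longrightarrow> is_range_proj P' (pos_part S') \<Longrightarrow> norm (P' - P) \<le> C * dist S' B"
    using range_proj_lipschitz_stratum[OF B P] by metis
  define d where "d = dist A B"
  define u :: real where "u = 2 * sqrt 2 - sqrt 6"
  have "sqrt 6 < sqrt 8" by simp
  moreover have "sqrt 8 = 2 * sqrt (2 :: real)"
    using real_sqrt_mult[of 4 2] by simp
  ultimately have u: "0 < u" by (simp add: u_def)
  \<comment> \<open>The first bound makes the pair \<open>S\<close>, \<open>B\<close> nondegenerate;
    the second keeps the cost \<open>2 * sqrt 6 * e\<close> of the detour within the slack
    \<open>u * d\<close>.\<close>
  define e where "e = min (1 / C) (u * d / (2 * sqrt 6))"
  have e: "0 < e" using C(1) u False by (simp add: e_def d_def)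
  obtain S where S: "S \<in> stratum k" "nondegenerate A S" "dist S B < e"
    using component_subset_closure[OF A AB] e unfolding closure_approachable by blast
  obtain P' where P': "is_range_proj P' (pos_part S)" using range_proj_exists by blast
  have "C * dist S B < 1"
  proof -
    have "dist S B < 1 / C" using S(3) by (simp add: e_def)
    then show ?thesis using C(1) by (simp add: field_simps)
  qed
  then have "norm (P' - P) < 1" using C(2)[OF S(1) P'] by linarith
  then have "nondegenerate S B" by (rule nondegenerate_of_close[OF P' P])
  then have "joined_within (stratum k) A B (sqrt 6 * dist A S + sqrt 6 * dist S B)"
    using joined_within_trans joined_within_of_nondegenerate A B S by metis
  moreover have "sqrt 6 * dist A S + sqrt 6 * dist S B \<le> 2 * sqrt 2 * dist A B"
  proof -
    have "dist A S \<le> d + e" "dist S B \<le> e"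
      using S(3) dist_triangle[of A S B] by (simp_all add: d_def dist_commute)
    then have "sqrt 6 * dist A S + sqrt 6 * dist S B \<le> sqrt 6 * (d + e) + sqrt 6 * e"
      by (intro add_mono mult_left_mono) auto
    also have "\<dots> = sqrt 6 * d + 2 * sqrt 6 * e" by (simp add: algebra_simps)
    also have "2 * sqrt 6 * e \<le> 2 * sqrt 6 * (u * d / (2 * sqrt 6))"
      unfolding e_def by (intro mult_left_mono) auto
    also have "\<dots> = u * d" by simp
    also have "sqrt 6 * d + u * d = 2 * sqrt 2 * d" by (simp add: u_def algebra_simps)
    finally show ?thesis by (simp add: d_def)
  qed
  ultimately show ?thesis by (rule joined_within_mono)
qed

end

section \<open>The matrix spaces as spaces of odd matrices\<close>

text \<open>A common scale factor cancels in the comparison. It is used with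
  \<open>c = sqrt 2\<close>, \<open>d = 2\<close> for real and \<open>c = 2\<close>,
  \<open>d = 4\<close> for complex matrices.\<close>

lemma (in graded_symmetry) inner_dist_bounds:
  fixes f :: "('a::real_normed_field) ^ 'n ^ 'm \<Rightarrow> real ^ 'h ^ 'h"
  assumes f: "\<And>A B. dist (f A) (f B) = c * dist A B" and c: "0 < c"
    and rank: "\<And>A. rank (f A) = d * rank A" and d: "0 < d"
    and X: "f ` X = odd_mats" and AB: "connected_component (rank_stratum X r) A B"
  shows "inner_dist (rank_stratum X r) A B / ereal (2 * sqrt 2) \<le> ereal (dist A B) \<and>
    ereal (dist A B) \<le> inner_dist (rank_stratum X r) A B"
proof
  have im: "f ` rank_stratum X r = stratum (d * r)"
    using d by (auto simp: rank_stratum_def stratum_def rank X[symmetric])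
  have "continuous_on (rank_stratum X r) f"
    unfolding continuous_on_iff f using c
    by (metis pos_less_divide_eq mult.commute divide_pos_pos)
  then have "connected_component (stratum (d * r)) (f A) (f B)"
    using connected_component_continuous_image[OF _ AB] im by metis
  then have "joined_within (f ` rank_stratum X r) (f A) (f B) (c * (2 * sqrt 2 * dist A B))"
    using stratum_joined_within im f by (metis mult.left_commute)
  then have "joined_within (rank_stratum X r) A B (2 * sqrt 2 * dist A B)"
    using joined_within_similarity[OF f c] connected_component_in[OF AB] by blast
  then have "inner_dist (rank_stratum X r) A B \<le> ereal (2 * sqrt 2 * dist A B)"
    by (rule inner_dist_le_joined_within)
  also have "\<dots> = ereal (2 * sqrt 2) * ereal (dist A B)" by simp
  finally show "inner_dist (rank_stratum X r) A B / ereal (2 * sqrt 2) \<le> ereal (dist A B)"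
    by (subst ereal_divide_le_pos) auto
qed (rule dist_le_inner_dist)

lemma dilation_diff: "dilation (A - B) = dilation A - dilation B"
  by (simp add: dilation_def blk_arith transpose_diff)

lemma norm_dilation: "norm (dilation A) = sqrt 2 * norm A"
  by (simp add: norm_eq_sqrt_inner dilation_def inner_blk inner_transpose flip: real_sqrt_mult)

lemma dist_dilation: "dist (dilation A) (dilation B) = sqrt 2 * dist A B"
  by (simp add: dist_norm norm_dilation flip: dilation_diff)

text \<open>The range is the direct sum of the ranges of \<open>A\<close> and of its transpose,
  placed in complementary blocks.\<close>

lemma rank_dilation:
  fixes A :: "real ^ 'n ^ 'm"
  shows "rank (dilation A) = 2 * rank A"
proof -
  define E where "E = range ((*v) A)"
  define F where "F = range ((*v) (transpose A))"
  let ?l = "\<lambda>x. vjoin x (0 :: real ^ 'n)" and ?r = "\<lambda>y. vjoin (0 :: real ^ 'm) y"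
  have sub: "subspace E" "subspace F"
    unfolding E_def F_def by (intro linear_subspace_image; simp del: transpose_matrix_vector)+
  have lin: "linear ?l" "linear ?r"
    by (rule linearI; simp add: vec_eq_iff all_sum_iff)+
  have inj: "inj ?l" "inj ?r" by (auto intro!: injI)
  have dims: "dim (?l ` E) = dim E" "dim (?r ` F) = dim F"
    using lin inj by (auto intro!: dim_image_eq intro: inj_on_subset)
  have "?l ` E \<inter> ?r ` F = {0}"
    using subspace_0[OF sub(1)] subspace_0[OF sub(2)] by (force simp flip: vjoin_arith(4))
  moreover have "range ((*v) (dilation A)) = {x + y | x y. x \<in> ?l ` E \<and> y \<in> ?r ` F}"
  proof -
    have "dilation A *v vjoin x y = ?l (A *v y) + ?r (transpose A *v x)" for x y
      by (simp add: dilation_def blk_mult_vector vjoin_arith del: transpose_matrix_vector)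
    note app = this
    show ?thesis
    proof (intro subset_antisym subsetI)
      fix z assume "z \<in> range ((*v) (dilation A))"
      then obtain x y where "z = dilation A *v vjoin x y" by (metis imageE vjoin_cases)
      then show "z \<in> {x + y | x y. x \<in> ?l ` E \<and> y \<in> ?r ` F}"
        unfolding app E_def F_def by blast
    next
      fix z assume "z \<in> {x + y | x y. x \<in> ?l ` E \<and> y \<in> ?r ` F}"
      then obtain x y where "z = ?l (A *v y) + ?r (transpose A *v x)"
        unfolding E_def F_def by blast
      then show "z \<in> range ((*v) (dilation A))" unfolding app[symmetric] by blast
    qed
  qed
  ultimately have "rank (dilation A) = dim E + dim F"
    using dim_sums_Int[OF linear_subspace_image[OF lin(1) sub(1)] linear_subspace_image[OF lin(2) sub(2)]]
    by (simp add: dims rank_dim_range)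
  then show ?thesis
    using rank_transpose[of A] by (simp add: E_def F_def rank_dim_range del: transpose_matrix_vector)
qed

lemma graded_odd_mats:
  assumes "graded_symmetry grading G"
  shows "graded_symmetry.odd_mats grading G = dilation ` {A. \<forall>g\<in>G. g ** dilation A = dilation A ** g}"
  unfolding graded_symmetry.odd_mats_def[OF assms]
  using odd_grading_iff by (auto simp: image_iff) metis+

section \<open>Complex matrices as real block matrices\<close>

definition realify :: "complex ^ 'n ^ 'm \<Rightarrow> real ^ ('n + 'n) ^ ('m + 'm)"
  where "realify A = blk (map_matrix Re A) (- map_matrix Im A) (map_matrix Im A) (map_matrix Re A)"

lemma realify_diff: "realify (A - B) = realify A - realify B"
  by (simp add: realify_def map_matrix_def vec_eq_iff all_sum_iff)

lemma norm_realify: "norm (realify A) = sqrt 2 * norm A"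
proof -
  have "(norm (realify A))\<^sup>2 = 2 * (\<Sum>i\<in>UNIV. \<Sum>j\<in>UNIV. (Re (A$i$j))\<^sup>2 + (Im (A$i$j))\<^sup>2)"
    by (simp add: power2_norm_eq_inner realify_def inner_blk)
       (simp add: inner_vec_def map_matrix_def sum.distrib power2_eq_square)
  also have "(\<Sum>i\<in>UNIV. \<Sum>j\<in>UNIV. (Re (A$i$j))\<^sup>2 + (Im (A$i$j))\<^sup>2) = (norm A)\<^sup>2"
    by (simp add: norm_vec_def L2_set_def sum_nonneg cmod_power2)
  finally have "(norm (realify A))\<^sup>2 = (sqrt 2 * norm A)\<^sup>2" by (simp add: power_mult_distrib)
  then show ?thesis by (simp add: power2_eq_iff_nonneg)
qed

lemma dist_dilation_realify: "dist (dilation (realify A)) (dilation (realify B)) = 2 * dist A B"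
  unfolding dist_dilation by (simp add: dist_norm norm_realify flip: realify_diff mult.assoc)

lemma scaleR_eq_smult: "r *\<^sub>R x = complex_of_real r *s x"
  unfolding vec_eq_iff vector_scaleR_component vector_smult_component by (simp add: scaleR_conv_of_real)

lemma rows_eq_range: "rows A = range (\<lambda>i. row i A)"
  by (auto simp: rows_def)

text \<open>The factor \<open>- \<i>\<close> matches the lower rows of \<open>realify A\<close>; the
  real span is closed under it because applying it twice gives a sign.\<close>

lemma span_eq_complex_span:
  fixes R :: "(complex ^ 'n) set"
  shows "span (R \<union> (*s) (- \<i>) ` R) = vec.span R"
proof (rule subset_antisym)
  have "subspace (vec.span R)"
    unfolding subspace_def scaleR_eq_smult using vec.span_add vec.span_scale vec.span_zero by blast
  then show "span (R \<union> (*s) (- \<i>) ` R) \<subseteq> vec.span R"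
    by (intro span_minimal) (auto intro: vec.span_base vec.span_neg vec.span_scale)
  let ?W = "span (R \<union> (*s) (- \<i>) ` R)"
  have lin: "linear ((*s) (- \<i>) :: complex ^ 'n \<Rightarrow> _)"
    by (rule linearI) (simp_all add: vec_eq_iff algebra_simps)
  have rot: "(- \<i>) *s x \<in> ?W" if "x \<in> ?W" for x
  proof -
    have "(*s) (- \<i>) ` (R \<union> (*s) (- \<i>) ` R) \<subseteq> ?W"
      unfolding image_Un
    proof (rule Un_least)
      show "(*s) (- \<i>) ` R \<subseteq> ?W" by (auto intro: span_base)
    next
      have "(- \<i>) *s ((- \<i>) *s y) = - y" for y :: "complex ^ 'n"
        by (simp add: vec_eq_iff flip: mult.assoc)
      moreover have "- y \<in> ?W" if "y \<in> R" for y
        using that by (intro span_neg span_base) blast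
      ultimately show "(*s) (- \<i>) ` (*s) (- \<i>) ` R \<subseteq> ?W"
        by (simp only: image_image image_subset_iff) blast
    qed
    then have "span ((*s) (- \<i>) ` (R \<union> (*s) (- \<i>) ` R)) \<subseteq> ?W"
      by (intro span_minimal) auto
    then show ?thesis using that unfolding linear_span_image[OF lin] by blast
  qed
  have "vec.subspace ?W"
    unfolding vec.subspace_def
  proof (intro conjI ballI allI)
    fix z x assume x: "x \<in> ?W"
    have "z *s x = Re z *\<^sub>R x + (- Im z) *\<^sub>R ((- \<i>) *s x)"
      by (simp add: vec_eq_iff complex_eq_iff)
    then show "z *s x \<in> ?W" using x rot[OF x] by (metis span_add span_scale)
  qed (auto intro: span_add span_zero)
  then show "vec.span R \<subseteq> ?W"
    by (intro vec.span_minimal) (auto intro: span_base)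
qed

text \<open>Each new generator contributes either no real dimension or two.\<close>

lemma dim_complexified:
  fixes R :: "(complex ^ 'n) set"
  assumes "finite R"
  shows "dim (R \<union> (*s) (- \<i>) ` R) = 2 * vec.dim R"
  using assms
proof induction
  case empty
  then show ?case by simp
next
  case (insert b R)
  define T where "T = R \<union> (*s) (- \<i>) ` R"
  define c where "c = (- \<i>) *s b"
  have T: "insert b R \<union> (*s) (- \<i>) ` insert b R = insert c (insert b T)"
    by (auto simp: T_def c_def)
  have sp: "span T = vec.span R" unfolding T_def by (rule span_eq_complex_span)
  have IH: "dim T = 2 * vec.dim R" unfolding T_def by (rule insert.IH)
  show ?case
  proof (cases "b \<in> vec.span R")
    case True
    then have "c \<in> span T" unfolding sp c_def by (rule vec.span_scale)
    then have "c \<in> span (insert b T)" by (meson span_mono subset_insertI subsetD)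
    then show ?thesis
      using True unfolding T by (simp add: dim_insert vec.dim_insert sp IH)
  next
    case False
    have "c \<notin> span (insert b T)"
    proof
      assume "c \<in> span (insert b T)"
      then obtain k where "c - k *\<^sub>R b \<in> vec.span R"
        using sp by (metis span_breakdown_eq)
      \<comment> \<open>If \<open>c\<close> depended on \<open>b\<close> with real coefficient
        \<open>k\<close>, then \<open>z *s b\<close> would lie in the complex span; \<open>z\<close>
        has imaginary part -1 and can be divided out.\<close>
      moreover define z where "z = - \<i> - complex_of_real k"
      have "c - k *\<^sub>R b = z *s b"
        by (simp add: c_def z_def scaleR_eq_smult vec.scale_left_diff_distrib)
      ultimately have "inverse z *s (z *s b) \<in> vec.span R"
        using vec.span_scale by metis
      moreover have "z \<noteq> 0" by (simp add: z_def complex_eq_iff)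
      ultimately have "b \<in> vec.span R" by (simp add: vector_smult_assoc)
      then show False using False by blast
    qed
    then show ?thesis
      using False unfolding T by (simp add: dim_insert vec.dim_insert sp IH)
  qed
qed

text \<open>Under the real-linear embedding \<open>?f\<close> the rows of \<open>realify A\<close>
  are the rows of \<open>A\<close> and their multiples by \<open>- \<i>\<close>.\<close>

lemma rank_realify: "rank (realify A) = 2 * rank A"
proof -
  let ?f = "\<lambda>v :: complex ^ 'a. vjoin (\<chi> j. Re (v $ j)) (\<chi> j. - Im (v $ j))"
  have lin: "linear ?f" by (rule linearI) (simp_all add: vec_eq_iff all_sum_iff)
  have inj: "inj ?f" by (rule injI, simp only: vjoin_eq_iff) (simp add: vec_eq_iff complex_eq_iff)
  have rows: "row (Inl i) (realify A) = ?f (row i A)" "row (Inr i) (realify A) = ?f ((- \<i>) *s row i A)" for i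
    by (simp_all add: row_def realify_def vec_eq_iff all_sum_iff map_matrix_def)
  have "rows (realify A) = ?f ` (rows A \<union> (*s) (- \<i>) ` rows A)"
    unfolding rows_eq_range UNIV_Plus_UNIV[symmetric] Plus_def image_Un image_image rows ..
  then have "rank (realify A) = dim (rows A \<union> (*s) (- \<i>) ` rows A)"
    unfolding row_rank_def using lin inj by (simp add: dim_image_eq inj_on_subset)
  also have "\<dots> = 2 * rank A"
    unfolding row_rank_def_gen by (rule dim_complexified) (simp add: rows_eq_range)
  finally show ?thesis .
qed

lemma rank_dilation_realify: "rank (dilation (realify A)) = 4 * rank A"
  by (simp add: rank_dilation rank_realify)

section \<open>Complex structure and symmetry conditions as commutation relations\<close>

text \<open>Multiplication by \<open>\<i>\<close> on real coordinates; commuting with it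
  characterises complex linearity.\<close>

definition turn :: "real ^ ('n::finite + 'n) ^ ('n + 'n)"
  where "turn = blk 0 (- mat 1) (mat 1) 0"

lemma range_realify: "range (realify :: complex ^ 'n ^ 'm \<Rightarrow> _) = {B. turn ** B = B ** turn}"
proof (intro set_eqI iffI)
  fix B :: "real ^ ('n + 'n) ^ ('m + 'm)"
  obtain C D E F where B: "B = blk C D E F" by (rule blk_cases)
  show "B \<in> {B. turn ** B = B ** turn}" if "B \<in> range (realify :: complex ^ 'n ^ 'm \<Rightarrow> _)"
    using that by (auto simp: realify_def turn_def blk_mult matrix_arith)
  assume "B \<in> {B. turn ** B = B ** turn}"
  then have "blk (- E) (- F) C D = blk D (- C) F (- E)"
    by (simp only: mem_Collect_eq B turn_def blk_mult matrix_minus_left matrix_minus_right matrix_mul_lid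
        matrix_mul_rid matrix_mult_zero_left matrix_mult_zero_right add_0_left add_0_right)
  then have "D = - E" "C = F" unfolding blk_eq_iff by blast+
  then have "B = realify (\<chi> i j. Complex (C$i$j) (E$i$j))"
    unfolding B realify_def blk_eq_iff by (simp add: map_matrix_def vec_eq_iff)
  then show "B \<in> range (realify :: complex ^ 'n ^ 'm \<Rightarrow> _)" by blast
qed

definition block_turn :: "real ^ (('m::finite + 'm) + ('n::finite + 'n)) ^ (('m + 'm) + ('n + 'n))"
  where "block_turn = blk turn 0 0 turn"

lemma transpose_turn: "transpose turn = - turn"
  by (simp add: turn_def transpose_blk transpose_minus blk_arith)

text \<open>The relations for \<open>B\<close> and for its transpose are equivalent, since
  \<open>turn\<close> is skew-symmetric.\<close>

lemma block_turn_commute_iff: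
  "block_turn ** dilation B = dilation B ** block_turn \<longleftrightarrow> turn ** B = B ** turn"
proof -
  have "turn ** B = B ** turn \<longleftrightarrow> transpose (turn ** B) = transpose (B ** turn)" by simp
  also have "\<dots> \<longleftrightarrow> turn ** transpose B = transpose B ** turn"
    by (simp only: matrix_transpose_mul transpose_turn matrix_minus_left matrix_minus_right
        neg_equal_iff_equal eq_commute[of "transpose B ** turn"])
  finally have "turn ** B = B ** turn \<longleftrightarrow> turn ** transpose B = transpose B ** turn" .
  moreover have "block_turn ** dilation B = dilation B ** block_turn \<longleftrightarrow>
      turn ** B = B ** turn \<and> turn ** transpose B = transpose B ** turn"
    by (simp add: block_turn_def dilation_def blk_mult)
  ultimately show ?thesis by blast
qed

lemma block_turn_orthogonal: "orthogonal_matrix block_turn"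
  and block_turn_grading: "block_turn ** grading = grading ** block_turn"
  by (simp_all add: orthogonal_matrix_def block_turn_def turn_def grading_def transpose_blk blk_mult
      transpose_minus matrix_arith blk_mat_one)

text \<open>Commuting with it encodes \<open>C ** transpose A = s *\<^sub>R (A ** C)\<close>, with
  \<open>s = 1\<close> for symmetric and \<open>s = -1\<close> for skew-symmetric matrices.
  \<open>C\<close> is the identity in the real case and \<open>grading\<close> in the complex
  one.\<close>

definition twist :: "real ^ 'n ^ 'n \<Rightarrow> real \<Rightarrow> real ^ ('n + 'n) ^ ('n + 'n)"
  where "twist C s = blk 0 C (s *\<^sub>R C) 0"

lemma twist_orthogonal:
  assumes "transpose C = C" "C ** C = mat 1" "s * s = 1"
  shows "orthogonal_matrix (twist C s)"
  using assms by (simp add: orthogonal_matrix_def twist_def transpose_blk transpose_scalar blk_mult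
      matrix_arith blk_mat_one)

lemma twist_grading: "twist C s ** grading = - (grading ** twist C s)"
  by (simp add: twist_def grading_def blk_mult matrix_arith blk_arith)

lemma twist_commute_iff:
  assumes "C ** C = mat 1"
  shows "twist C s ** dilation A = dilation A ** twist C s \<longleftrightarrow> C ** transpose A = s *\<^sub>R (A ** C)"
proof -
  have "transpose A ** C = s *\<^sub>R (C ** A)" if "C ** transpose A = s *\<^sub>R (A ** C)"
  proof -
    have "transpose A ** C = C ** (C ** transpose A) ** C" by (simp add: matrix_mul_assoc assms)
    also have "\<dots> = s *\<^sub>R (C ** A ** (C ** C))"
      unfolding that by (simp add: matrix_scaleR_left matrix_scaleR_right matrix_mul_assoc)
    finally show ?thesis by (simp add: assms)
  qed
  then show ?thesis
    by (auto simp: twist_def dilation_def blk_mult matrix_scaleR_left matrix_scaleR_right)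
qed

lemma grading_square: "transpose grading = grading" "grading ** grading = mat 1"
  by (simp_all add: grading_def transpose_blk transpose_minus blk_mult matrix_arith blk_mat_one)

text \<open>The transpose of \<open>realify A\<close> represents the conjugate transpose of
  \<open>A\<close>; conjugation by \<open>grading\<close> flips the sign of the imaginary blocks and
  so leaves the bilinear transpose.\<close>

lemma realify_twist_iff:
  "grading ** transpose (realify A) = s *\<^sub>R (realify A ** grading) \<longleftrightarrow> transpose A = s *\<^sub>R A"
proof -
  have scale: "s *\<^sub>R blk B C D E = blk (s *\<^sub>R B) (s *\<^sub>R C) (s *\<^sub>R D) (s *\<^sub>R E)"
    for B C D E :: "real ^ 'a ^ 'a"
    by (simp add: vec_eq_iff all_sum_iff)
  have "grading ** transpose (realify A) = s *\<^sub>R (realify A ** grading) \<longleftrightarrow>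
      transpose (map_matrix Re A) = s *\<^sub>R map_matrix Re A \<and> transpose (map_matrix Im A) = s *\<^sub>R map_matrix Im A"
    by (auto simp: realify_def grading_def transpose_blk blk_mult scale transpose_minus
        matrix_minus_left matrix_minus_right)
  also have "\<dots> \<longleftrightarrow> transpose A = s *\<^sub>R A"
    by (auto simp: vec_eq_iff transpose_def map_matrix_def complex_eq_iff)
  finally show ?thesis .
qed

lemma real_matrix_inner_dist_bounds:
  fixes A B :: "real ^ 'n ^ 'm"
  assumes "connected_component (rank_stratum UNIV r) A B"
  shows "inner_dist (rank_stratum UNIV r) A B / ereal (2 * sqrt 2) \<le> ereal (dist A B) \<and>
    ereal (dist A B) \<le> inner_dist (rank_stratum UNIV r) A B"
proof -
  have gs: "graded_symmetry (grading :: real ^ ('m + 'n) ^ ('m + 'n)) {}"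
    by (rule graded_symmetry_grading) auto
  show ?thesis
    by (rule graded_symmetry.inner_dist_bounds[OF gs dist_dilation _ rank_dilation _ _ assms])
       (auto simp: graded_odd_mats[OF gs])
qed

lemma real_twisted_inner_dist_bounds:
  fixes A B :: "real ^ 'n ^ 'n"
  assumes s: "s * s = 1" and AB: "connected_component (rank_stratum {A. transpose A = s *\<^sub>R A} r) A B"
  shows "inner_dist (rank_stratum {A. transpose A = s *\<^sub>R A} r) A B / ereal (2 * sqrt 2) \<le> ereal (dist A B) \<and>
    ereal (dist A B) \<le> inner_dist (rank_stratum {A. transpose A = s *\<^sub>R A} r) A B"
proof -
  let ?G = "{twist (mat 1 :: real ^ 'n ^ 'n) s}"
  have gs: "graded_symmetry grading ?G"
    by (rule graded_symmetry_grading) (auto simp: twist_orthogonal s twist_grading)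
  show ?thesis
    by (rule graded_symmetry.inner_dist_bounds[OF gs dist_dilation _ rank_dilation _ _ AB])
       (auto simp: graded_odd_mats[OF gs] twist_commute_iff)
qed

lemma complex_inner_dist_bounds:
  fixes A B :: "complex ^ 'n ^ 'm"
  assumes G: "\<And>g. g \<in> G \<Longrightarrow> orthogonal_matrix g" "\<And>g. g \<in> G \<Longrightarrow> g ** grading = - (grading ** g)"
    and X: "X = {A. \<forall>g\<in>G. g ** dilation (realify A) = dilation (realify A) ** g}"
    and AB: "connected_component (rank_stratum X r) A B"
  shows "inner_dist (rank_stratum X r) A B / ereal (2 * sqrt 2) \<le> ereal (dist A B) \<and>
    ereal (dist A B) \<le> inner_dist (rank_stratum X r) A B"
proof -
  have gs: "graded_symmetry grading (insert block_turn G)"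
    by (rule graded_symmetry_grading) (use G block_turn_orthogonal block_turn_grading in auto)
  have "(\<lambda>A. dilation (realify A)) ` X = graded_symmetry.odd_mats grading (insert block_turn G)"
    unfolding graded_odd_mats[OF gs]
  proof (intro subset_antisym image_subsetI)
    fix A assume "A \<in> X"
    moreover have "realify A \<in> {B. turn ** B = B ** turn}" unfolding range_realify[symmetric] by simp
    ultimately show "dilation (realify A) \<in>
        dilation ` {A. \<forall>g\<in>insert block_turn G. g ** dilation A = dilation A ** g}"
      by (auto simp: X block_turn_commute_iff)
  next
    fix B assume B: "B \<in> {A. \<forall>g\<in>insert block_turn G. g ** dilation A = dilation A ** g}"
    then have "B \<in> range realify" unfolding range_realify by (auto simp: block_turn_commute_iff)
    then show "dilation B \<in> (\<lambda>A. dilation (realify A)) ` X" using B by (auto simp: X)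
  qed
  then show ?thesis
    by (intro graded_symmetry.inner_dist_bounds[OF gs dist_dilation_realify _ rank_dilation_realify _ _ AB]) auto
qed

lemma complex_twisted_inner_dist_bounds:
  fixes A B :: "complex ^ 'n ^ 'n"
  assumes s: "s * s = 1" and AB: "connected_component (rank_stratum {A. transpose A = s *\<^sub>R A} r) A B"
  shows "inner_dist (rank_stratum {A. transpose A = s *\<^sub>R A} r) A B / ereal (2 * sqrt 2) \<le> ereal (dist A B) \<and>
    ereal (dist A B) \<le> inner_dist (rank_stratum {A. transpose A = s *\<^sub>R A} r) A B"
  by (rule complex_inner_dist_bounds[where G = "{twist grading s}", OF _ _ _ AB])
     (auto simp: twist_orthogonal grading_square s twist_grading twist_commute_iff realify_twist_iff)

lemma sym_or_skew_cases:
  assumes "X \<in> {sym_matrices, skew_matrices}"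
  obtains s :: real where "s * s = 1"
    "X = {A :: ('a::{comm_ring_1, real_vector}) ^ 'n ^ 'n. transpose A = s *\<^sub>R A}"
proof (cases "X = sym_matrices")
  case True
  then show ?thesis using that[of 1] by (simp add: sym_matrices_def)
next
  case False
  then show ?thesis using assms that[of "-1"] by (simp add: skew_matrices_def)
qed

theorem theorem4p3:
  shows
    "(\<forall>(A :: real ^ 'n ^ 'm) B r.
        CARD('m) \<le> CARD('n) \<and> r \<le> CARD('m) \<and>
        connected_component (rank_stratum UNIV r) A B \<longrightarrow>
        inner_dist (rank_stratum UNIV r) A B / ereal (2 * sqrt 2) \<le> ereal (d_out_real A B) \<and>
        ereal (d_out_real A B) \<le> inner_dist (rank_stratum UNIV r) A B) \<and>
     (\<forall>(A :: complex ^ 'n ^ 'm) B r.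
        CARD('m) \<le> CARD('n) \<and> r \<le> CARD('m) \<and>
        connected_component (rank_stratum UNIV r) A B \<longrightarrow>
        inner_dist (rank_stratum UNIV r) A B / ereal (2 * sqrt 2) \<le> ereal (d_out_complex A B) \<and>
        ereal (d_out_complex A B) \<le> inner_dist (rank_stratum UNIV r) A B) \<and>
     (\<forall>X \<in> {sym_matrices, skew_matrices}. \<forall>(A :: real ^ 'n ^ 'n) B r.
        r \<le> CARD('n) \<and> connected_component (rank_stratum X r) A B \<longrightarrow>
        inner_dist (rank_stratum X r) A B / ereal (2 * sqrt 2) \<le> ereal (d_out_real A B) \<and>
        ereal (d_out_real A B) \<le> inner_dist (rank_stratum X r) A B) \<and>
     (\<forall>X \<in> {sym_matrices, skew_matrices}. \<forall>(A :: complex ^ 'n ^ 'n) B r.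
        r \<le> CARD('n) \<and> connected_component (rank_stratum X r) A B \<longrightarrow>
        inner_dist (rank_stratum X r) A B / ereal (2 * sqrt 2) \<le> ereal (d_out_complex A B) \<and>
        ereal (d_out_complex A B) \<le> inner_dist (rank_stratum X r) A B)"
proof -
  have r: "inner_dist (rank_stratum X r) A B / ereal (2 * sqrt 2) \<le> ereal (dist A B) \<and>
      ereal (dist A B) \<le> inner_dist (rank_stratum X r) A B"
    if X: "X \<in> {sym_matrices, skew_matrices}" and "connected_component (rank_stratum X r) A B"
    for X and A B :: "real ^ 'n ^ 'n" and r
    using that(2) real_twisted_inner_dist_bounds by (rule_tac sym_or_skew_cases[OF X]) blast
  have c: "inner_dist (rank_stratum X r) A B / ereal (2 * sqrt 2) \<le> ereal (dist A B) \<and>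
      ereal (dist A B) \<le> inner_dist (rank_stratum X r) A B"
    if X: "X \<in> {sym_matrices, skew_matrices}" and "connected_component (rank_stratum X r) A B"
    for X and A B :: "complex ^ 'n ^ 'n" and r
    using that(2) complex_twisted_inner_dist_bounds by (rule_tac sym_or_skew_cases[OF X]) blast
  have m: "inner_dist (rank_stratum UNIV r) A B / ereal (2 * sqrt 2) \<le> ereal (dist A B) \<and>
      ereal (dist A B) \<le> inner_dist (rank_stratum UNIV r) A B"
    if "connected_component (rank_stratum UNIV r) A B" for A B :: "complex ^ 'n ^ 'm" and r
    by (rule complex_inner_dist_bounds[where G = "{}", OF _ _ _ that]) auto
  note * = real_matrix_inner_dist_bounds m r c
  show ?thesis
    unfolding d_out_real_eq_dist d_out_complex_eq_dist
    by (intro conjI allI ballI impI; elim conjE; rule *[THEN conjunct1] *[THEN conjunct2]; assumption)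
qed

end
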